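(* Let $P \subseteq \mathbb{R}^n$ be an $n$-dimensional lattice polytope with $P \ncong \Delta_n$. If $n > d^F(P)$, then $P$ is (up to lattice equivalence) a Cayley sum $P_0 \ast \cdots \ast P_t$ of lattice polytopes $P_0,\dots,P_t \subseteq \mathbb{R}^m$ for some $m \leq d^F(P)$.
   Context: Let $n\ge 1$. A lattice polytope in $\mathbb{R}^n$ is the convex hull of finitely many points of $\mathbb{Z}^n$. Two lattice polytopes are lattice equivalent, written $P \cong Q$, if there is an affine lattice isomorphism mapping $P$ onto $Q$. $\Delta_n = \operatorname{conv}(0,e_1,\dots,e_n)$ is the standard simplex, where $e_1,\dots,e_n$ is the standard basis of $\mathbb{R}^n$. Fine adjoint polytope: for an $n$-dimensional rational polytope $P\subseteq\mathbb{R}^n$ and $\alpha \in (\mathbb{R}^n)^*$ put $d_P^F(\alpha) := \min_{x\in P}\langle \alpha, x\rangle$. For real $s>0$ let $$P^{F(s)} := \{x\in\mathbb{R}^n \mid \langle a,x\rangle \ge d_P^F(a)+s \text{ for all } a\in(\mathbb{Z}^n)^*\setminus\{0\}\}.$$ Fine $\mathbb{Q}$-codegree: $\mu^F(P) := \left(\sup\{s>0 \mid P^{F(s)}\neq\emptyset\}\right)^{-1}$. Define $$d^F(P) := \begin{cases} 2(n-\lfloor \mu^F(P)\rfloor), & \text{if } \mu^F(P)\notin\mathbb{N},\\ 2(n-\mu^F(P))+1, & \text{if } \mu^F(P)\in\mathbb{N}.\end{cases}$$ Cayley sum: given lattice polytopes $P_0,\dots,P_t\subseteq\mathbb{R}^k$,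 the Cayley sum $P_0\ast\cdots\ast P_t$ is the convex hull of $$(P_0\times 0)\cup(P_1\times e_1)\cup\cdots\cup(P_t\times e_t)\subseteq\mathbb{R}^k\times\mathbb{R}^t,$$ where $e_1,\dots,e_t$ is the standard basis of $\mathbb{R}^t$. *)

theory Defs
  imports "HOL-Analysis.Analysis" "HOL-Analysis.Finite_Function_Topology"
begin

text \<open>
  The ambient space of the given polytope is \<open>real ^ 'n\<close>. The polytopes occurring in a Cayley
  sum live in a space whose dimension is existentially quantified, so there \<open>\<real>\<^sup>m\<close> is modelled as the
  subspace of vectors \<open>nat \<Rightarrow>\<^sub>0 real\<close> with coordinates indexed by \<open>{1..m}\<close>. The general notions are
  therefore parametrised by a lattice \<open>L\<close>, the vector space in question being \<open>span L\<close>.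
\<close>

definition int_vecs :: "(real ^ 'n) set" where
  "int_vecs = {x. \<forall>i. x $ i \<in> \<int>}"

definition int_vecs_dim :: "nat \<Rightarrow> (nat \<Rightarrow>\<^sub>0 real) set" where
  "int_vecs_dim m =
     {x. Poly_Mapping.keys x \<subseteq> {1..m} \<and> (\<forall>i. Poly_Mapping.lookup x i \<in> \<int>)}"

definition lattice_polytope :: "'a::real_vector set \<Rightarrow> 'a set \<Rightarrow> bool" where
  "lattice_polytope L P \<longleftrightarrow> (\<exists>S. finite S \<and> S \<noteq> {} \<and> S \<subseteq> L \<and> P = convex hull S)"

definition affine_lattice_iso ::
  "'a::real_vector set \<Rightarrow> 'b::real_vector set \<Rightarrow> ('a \<Rightarrow> 'b) \<Rightarrow> bool" where
  "affine_lattice_iso L M f \<longleftrightarrow>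
     (\<exists>g c. linear g \<and> (\<forall>x \<in> span L. f x = g x + c)) \<and>
     bij_betw f (span L) (span M) \<and> f ` L = M"

definition lattice_equiv ::
  "'a::real_vector set \<Rightarrow> 'a set \<Rightarrow> 'b::real_vector set \<Rightarrow> 'b set \<Rightarrow> bool" where
  "lattice_equiv L P M Q \<longleftrightarrow> (\<exists>f. affine_lattice_iso L M f \<and> f ` P = Q)"

definition std_simplex :: "(real ^ 'n) set" where
  "std_simplex = convex hull (insert 0 Basis)"

text \<open>
  Dual vectors are identified with vectors via the inner product, which identifies the dual
  lattice with \<^const>\<open>int_vecs\<close>. The infimum is attained, hence a minimum, for nonempty
  compact \<open>P\<close>.
\<close>

definition dist_fine :: "(real ^ 'n) set \<Rightarrow> real ^ 'n \<Rightarrow> real" where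
  "dist_fine P a = (INF x\<in>P. a \<bullet> x)"

definition fine_adjoint :: "(real ^ 'n) set \<Rightarrow> real \<Rightarrow> (real ^ 'n) set" where
  "fine_adjoint P s = {x. \<forall>a \<in> int_vecs - {0}. a \<bullet> x \<ge> dist_fine P a + s}"

definition fine_codegree :: "(real ^ 'n) set \<Rightarrow> real" where
  "fine_codegree P = inverse (Sup {s. s > 0 \<and> fine_adjoint P s \<noteq> {}})"

definition dF :: "(real ^ 'n) set \<Rightarrow> real" where
  "dF P = (if fine_codegree P \<notin> \<nat>
           then 2 * (real CARD('n) - of_int \<lfloor>fine_codegree P\<rfloor>)
           else 2 * (real CARD('n) - fine_codegree P) + 1)"

text \<open>The vertices of the standard simplex in \<open>\<real>\<^sup>t\<close>: the origin for \<open>i = 0\<close>, and \<open>e\<^sub>i\<close> for \<open>i \<ge> 1\<close>.\<close>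

definition cayley_vertex :: "nat \<Rightarrow> (nat \<Rightarrow>\<^sub>0 real)" where
  "cayley_vertex i = (if i = 0 then 0 else Poly_Mapping.single i 1)"

definition cayley_sum ::
  "nat \<Rightarrow> (nat \<Rightarrow> (nat \<Rightarrow>\<^sub>0 real) set) \<Rightarrow> ((nat \<Rightarrow>\<^sub>0 real) \<times> (nat \<Rightarrow>\<^sub>0 real)) set" where
  "cayley_sum t Q = convex hull (\<Union>i\<in>{0..t}. Q i \<times> {cayley_vertex i})"

end

theory Submission
  imports Defs
begin

text \<open>
  Let \<open>K\<close> be the cone of affine functions that are nonnegative on \<open>P\<close>. For \<open>\<nu> < \<mu>\<^sup>F(P)\<close> linear
  programming duality writes the constant function 1 as a combination of nonzero integral members
  of \<open>K\<close> with nonnegative weights of total at least \<open>\<nu>\<close>, and the members may be taken linearly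
  independent, so there are at most \<open>n + 1\<close> of them. At a vertex of \<open>P\<close> their values are
  nonnegative integers of weighted sum 1, hence at most one member of weight above 1/2 does not
  vanish there, and it takes the value 1. Thus the members of weight above 1/2, together with the
  remainder if it is nonzero, write 1 as a sum of \<open>t + 1\<close> nonzero integral members of \<open>K\<close>. Every
  other weight is at most 1/2, which gives \<open>2\<nu> \<le> n + 1 + t\<close> unless \<open>t = n\<close> and \<open>P\<close> is a unimodular
  simplex. Such a sum maps \<open>P\<close> onto the standard simplex of dimension \<open>t\<close> by a surjection of lattices,
  which exhibits \<open>P\<close> as a Cayley sum of polytopes in dimension \<open>n - t\<close>.
\<close>

section \<open>Bases of integer lattices\<close>

text \<open>Coefficients are indexed by the vectors themselves, so no enumeration of
  \<open>B\<close> is chosen. The notion is meant for finite \<open>B\<close>: over an infinite set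
  every sum is 0 by convention.\<close>

definition int_span :: "'a::real_vector set \<Rightarrow> 'a set" where
  "int_span B = range (\<lambda>c :: 'a \<Rightarrow> int. \<Sum>b\<in>B. of_int (c b) *\<^sub>R b)"

lemma int_span_insert:
  assumes "finite B" "b \<notin> B"
  shows "int_span (insert b B) = {of_int k *\<^sub>R b + y | k y. y \<in> int_span B}" (is "?L = ?R")
proof
  show "?L \<subseteq> ?R"
    using assms by (auto simp: int_span_def)
  show "?R \<subseteq> ?L"
  proof clarify
    fix k y assume "y \<in> int_span B"
    then obtain c :: "'a \<Rightarrow> int" where y: "y = (\<Sum>b\<in>B. of_int (c b) *\<^sub>R b)"
      by (auto simp: int_span_def)
    have "(\<Sum>a\<in>B. of_int ((c(b := k)) a) *\<^sub>R a) = y"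
      unfolding y using assms by (intro sum.cong) auto
    then have "of_int k *\<^sub>R b + y = (\<Sum>a\<in>insert b B. of_int ((c(b := k)) a) *\<^sub>R a)"
      using assms by simp
    then show "of_int k *\<^sub>R b + y \<in> ?L"
      unfolding int_span_def by blast
  qed
qed

text \<open>Injectivity on \<open>B\<close> allows coefficient functions to be transported along
  \<open>g\<close> in both directions.\<close>

lemma int_span_image:
  assumes "linear g" "inj_on g B"
  shows "g ` int_span B = int_span (g ` B)"
proof -
  have *: "g (\<Sum>b\<in>B. of_int (c b) *\<^sub>R b) = (\<Sum>b\<in>B. of_int (c b) *\<^sub>R g b)" for c :: "'a \<Rightarrow> int"
    using assms(1) by (simp add: linear_sum linear_scale)
  have 1: "g (\<Sum>b\<in>B. of_int (c b) *\<^sub>R b) =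
      (\<Sum>b\<in>g ` B. of_int ((c \<circ> the_inv_into B g) b) *\<^sub>R b)" for c :: "'a \<Rightarrow> int"
    unfolding * using assms(2) by (simp add: sum.reindex the_inv_into_f_f cong: sum.cong)
  have 2: "(\<Sum>b\<in>g ` B. of_int (c b) *\<^sub>R b) = g (\<Sum>b\<in>B. of_int ((c \<circ> g) b) *\<^sub>R b)" for c :: "'b \<Rightarrow> int"
    unfolding * using assms(2) by (simp add: sum.reindex)
  show ?thesis
    unfolding int_span_def
  proof (intro equalityI subsetI; elim imageE)
    fix x y c assume "x = g y" "y = (\<Sum>b\<in>B. of_int (c b :: int) *\<^sub>R b)"
    then show "x \<in> range (\<lambda>c :: 'b \<Rightarrow> int. \<Sum>b\<in>g ` B. of_int (c b) *\<^sub>R b)"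
      using 1[of c] by blast
  next
    fix x c assume "x = (\<Sum>b\<in>g ` B. of_int (c b :: int) *\<^sub>R b)"
    then show "x \<in> g ` range (\<lambda>c :: 'a \<Rightarrow> int. \<Sum>b\<in>B. of_int (c b) *\<^sub>R b)"
      using 2[of c] by blast
  qed
qed

text \<open>Subgroups are described throughout by containing 0 and being closed under subtraction;
  here \<open>x + y = x - (0 - y)\<close>.\<close>

lemma sub_closed_add:
  fixes \<Lambda> :: "'a::ab_group_add set"
  assumes "0 \<in> \<Lambda>" "\<And>x y. x \<in> \<Lambda> \<Longrightarrow> y \<in> \<Lambda> \<Longrightarrow> x - y \<in> \<Lambda>" "x \<in> \<Lambda>" "y \<in> \<Lambda>"
  shows "x + y \<in> \<Lambda>"
  using assms(2)[OF assms(3) assms(2)[OF assms(1,4)]] by simp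

lemma sub_closed_scale:
  fixes \<Lambda> :: "'a::real_vector set"
  assumes "0 \<in> \<Lambda>" "\<And>x y. x \<in> \<Lambda> \<Longrightarrow> y \<in> \<Lambda> \<Longrightarrow> x - y \<in> \<Lambda>" "x \<in> \<Lambda>"
  shows "of_int k *\<^sub>R x \<in> \<Lambda>"
proof (induction k rule: int_induct[where k = 0])
  case (step1 i)
  then show ?case
    using sub_closed_add[OF assms(1,2) step1(2) assms(3)] by (simp add: scaleR_add_left)
next
  case (step2 i)
  then show ?case
    using assms(2)[OF step2(2) assms(3)] by (simp add: scaleR_diff_left)
qed (use assms in simp)

lemma sub_closed_int_span:
  fixes \<Lambda> :: "'a::real_vector set"
  assumes "0 \<in> \<Lambda>" "\<And>x y. x \<in> \<Lambda> \<Longrightarrow> y \<in> \<Lambda> \<Longrightarrow> x - y \<in> \<Lambda>" "finite B" "B \<subseteq> \<Lambda>"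
  shows "int_span B \<subseteq> \<Lambda>"
  using assms(3,4)
proof (induction B rule: finite_induct)
  case empty
  then show ?case using assms(1) by (auto simp: int_span_def)
next
  case (insert b B)
  then show ?case
    using sub_closed_add[OF assms(1,2)] sub_closed_scale[OF assms(1,2)]
    by (auto simp: int_span_insert)
qed

lemma int_span_sub_span: "int_span B \<subseteq> span B"
  by (auto simp: int_span_def intro!: span_sum intro: span_scale span_base)

lemma int_span_superset:
  assumes "finite B" shows "B \<subseteq> int_span B"
proof
  fix b assume b: "b \<in> B"
  have "(\<Sum>a\<in>B. of_int (if a = b then 1 else 0) *\<^sub>R a) = (\<Sum>a\<in>B. if a = b then b else 0)"
    by (intro sum.cong) auto
  then have "b = (\<Sum>a\<in>B. of_int (if a = b then 1 else 0) *\<^sub>R a)"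
    using assms b by simp
  then show "b \<in> int_span B"
    unfolding int_span_def by (intro range_eqI[where x = "\<lambda>a. if a = b then 1 else 0"]) simp
qed

lemma span_int_span:
  assumes "finite B" shows "span (int_span B) = span B"
  using span_minimal[OF int_span_sub_span] span_mono[OF int_span_superset[OF assms]] by auto

section \<open>The lattice of integer vectors and bases of its subgroups\<close>

lemma int_vecs_diff: "x \<in> int_vecs \<Longrightarrow> y \<in> int_vecs \<Longrightarrow> x - y \<in> int_vecs"
  by (simp add: int_vecs_def)

lemma int_vecs_0: "0 \<in> int_vecs"
  by (simp add: int_vecs_def)

lemma int_vecs_inner: "x \<in> int_vecs \<Longrightarrow> y \<in> int_vecs \<Longrightarrow> x \<bullet> y \<in> \<int>"
  by (auto simp: int_vecs_def inner_vec_def intro!: Ints_sum Ints_mult)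

text \<open>The coordinates allowed to be nonzero are removed one at a time; the values of the removed
  coordinate form an ideal of \<open>\<int>\<close>, whose generator lifts to the new basis vector.\<close>

lemma int_subgroup_basis:
  fixes \<Lambda> :: "(real ^ 'n) set"
  assumes "finite I" "\<Lambda> \<subseteq> int_vecs" "\<And>x i. x \<in> \<Lambda> \<Longrightarrow> i \<notin> I \<Longrightarrow> x $ i = 0"
    and "0 \<in> \<Lambda>" "\<And>x y. x \<in> \<Lambda> \<Longrightarrow> y \<in> \<Lambda> \<Longrightarrow> x - y \<in> \<Lambda>"
  shows "\<exists>B. finite B \<and> independent B \<and> int_span B = \<Lambda>"
  using assms
proof (induction I arbitrary: \<Lambda> rule: finite_induct)
  case empty
  then have "\<Lambda> = {0}" by (auto simp: vec_eq_iff)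
  then show ?case by (intro exI[of _ "{}"]) (auto simp: int_span_def independent_empty)
next
  case (insert i I)
  note zero = insert.prems(3) and diff = insert.prems(4)
  define \<Lambda>' where "\<Lambda>' = {x \<in> \<Lambda>. x $ i = 0}"
  have "\<exists>B. finite B \<and> independent B \<and> int_span B = \<Lambda>'"
  proof (rule insert.IH)
    show "x $ j = 0" if "x \<in> \<Lambda>'" "j \<notin> I" for x j
      using insert.prems(2)[of x j] that by (cases "j = i") (auto simp: \<Lambda>'_def)
  qed (use insert.prems in \<open>auto simp: \<Lambda>'_def\<close>)
  then obtain B where B: "finite B" "independent B" "int_span B = \<Lambda>'" by blast
  show ?case
  proof (cases "\<exists>x\<in>\<Lambda>. x $ i \<noteq> 0")
    case False
    then have "\<Lambda>' = \<Lambda>" by (auto simp: \<Lambda>'_def)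
    with B show ?thesis by blast
  next
    case True
    have coord: "\<exists>k::int. x $ i = of_int k" if "x \<in> \<Lambda>" for x
    proof -
      have "x $ i \<in> \<int>" using insert.prems(1) that by (auto simp: int_vecs_def)
      then show ?thesis by (elim Ints_cases) auto
    qed
    define N where "N = (\<lambda>m::nat. m > 0 \<and> (\<exists>x\<in>\<Lambda>. x $ i = real m))"
    have "\<exists>m. N m"
    proof -
      from True obtain x k where x: "x \<in> \<Lambda>" "x $ i = of_int k" "k \<noteq> 0" using coord by fastforce
      have "0 - x \<in> \<Lambda>" using zero diff x by blast
      show ?thesis
      proof (cases "k > 0")
        case True
        then have "N (nat k)" unfolding N_def using x by (intro conjI bexI[of _ x]) auto
        then show ?thesis ..
      next
        case False
        then have "N (nat (- k))"
          unfolding N_def using x \<open>0 - x \<in> \<Lambda>\<close> by (intro conjI bexI[of _ "0 - x"]) auto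
        then show ?thesis ..
      qed
    qed
    define m where "m = (LEAST m. N m)"
    have "N m" unfolding m_def using \<open>\<exists>m. N m\<close> by (rule LeastI_ex)
    then obtain b where b: "b \<in> \<Lambda>" "b $ i = real m" and m: "m > 0" by (auto simp: N_def)
    \<comment> \<open>Coordinate \<open>i\<close> vanishes on \<open>span B\<close> but equals
      \<open>m > 0\<close> at \<open>b\<close>.\<close>
    have bB: "b \<notin> span B"
    proof
      assume "b \<in> span B"
      moreover have "span B \<subseteq> {x. x $ i = 0}"
      proof (rule span_minimal)
        show "B \<subseteq> {x. x $ i = 0}" using int_span_superset[OF B(1)] B(3) by (auto simp: \<Lambda>'_def)
        show "subspace {x::real^'n. x $ i = 0}" by (simp add: subspace_def)
      qed
      ultimately show False using b m by auto
    qed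
    then have bB': "b \<notin> B" using span_base by blast
    have "\<Lambda> \<subseteq> int_span (insert b B)"
    proof
      fix x assume x: "x \<in> \<Lambda>"
      then obtain k where k: "x $ i = of_int k" using coord by blast
      \<comment> \<open>Division with remainder: coordinate \<open>i\<close> of \<open>y\<close> is
        a value attained on \<open>\<Lambda>\<close> and smaller than \<open>m\<close>, so it is 0
        by minimality of \<open>m\<close>.\<close>
      define y where "y = x - of_int (k div int m) *\<^sub>R b"
      have y: "y \<in> \<Lambda>" unfolding y_def using diff x sub_closed_scale[OF zero diff b(1)] by blast
      have "y $ i = of_int (k - k div int m * int m)"
        by (simp only: y_def k b of_int_diff of_int_mult of_int_of_nat_eq
            vector_minus_component vector_scaleR_component real_scaleR_def)
      then have yi: "y $ i = of_int (k mod int m)"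
        by (simp only: minus_div_mult_eq_mod)
      have "k mod int m = 0"
      proof (rule ccontr)
        assume "k mod int m \<noteq> 0"
        moreover have "0 \<le> k mod int m" using m by (intro pos_mod_sign) simp
        ultimately have "0 < k mod int m" by simp
        then have "N (nat (k mod int m))" unfolding N_def using y yi by (intro conjI bexI[of _ y]) auto
        then have "m \<le> nat (k mod int m)" unfolding m_def by (rule Least_le)
        moreover have "k mod int m < int m" using m by simp
        ultimately show False using \<open>0 < k mod int m\<close> by linarith
      qed
      then have "y \<in> \<Lambda>'" using y yi by (simp add: \<Lambda>'_def)
      moreover have "x = of_int (k div int m) *\<^sub>R b + y" by (simp add: y_def)
      ultimately show "x \<in> int_span (insert b B)"
        unfolding int_span_insert[OF B(1) bB'] B(3) by blast
    qed
    moreover have "int_span (insert b B) \<subseteq> \<Lambda>"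
    proof (rule sub_closed_int_span[OF zero diff])
      show "insert b B \<subseteq> \<Lambda>"
        using b(1) int_span_superset[OF B(1)] unfolding B(3) \<Lambda>'_def by blast
    qed (use B in auto)
    moreover have "independent (insert b B)" using B(2) bB by (rule independent_insertI[rotated])
    ultimately show ?thesis
      using B(1) by (intro exI[of _ "insert b B"]) auto
  qed
qed

text \<open>Taking floors moves the values to the natural numbers, where a sum equal to 1 has
  exactly one nonzero summand. This is what assigns a lattice point to its layer.\<close>

lemma unit_sum_cases:
  fixes f :: "nat \<Rightarrow> real"
  assumes "\<And>i. i \<le> t \<Longrightarrow> f i \<in> \<int>" "\<And>i. i \<le> t \<Longrightarrow> 0 \<le> f i" "(\<Sum>i\<le>t. f i) = 1"
  shows "\<exists>i\<le>t. \<forall>j\<le>t. f j = (if j = i then 1 else 0)"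
proof -
  have *: "f i = real (nat \<lfloor>f i\<rfloor>)" if "i \<le> t" for i
    using assms(1,2)[OF that] by simp
  have "real (\<Sum>i\<le>t. nat \<lfloor>f i\<rfloor>) = (\<Sum>i\<le>t. f i)"
    unfolding of_nat_sum by (rule sum.cong) (use * in auto)
  then have "(\<Sum>i\<le>t. nat \<lfloor>f i\<rfloor>) = 1"
    using assms(3) by linarith
  then obtain i where i: "i \<le> t" "nat \<lfloor>f i\<rfloor> = 1" "\<forall>j\<le>t. i \<noteq> j \<longrightarrow> nat \<lfloor>f j\<rfloor> = 0"
    by (subst (asm) sum_eq_1_iff) auto
  have "f j = (if j = i then 1 else 0)" if j: "j \<le> t" for j
  proof -
    have "nat \<lfloor>f j\<rfloor> = (if j = i then 1 else 0)"
      using i(2,3) j by (cases "j = i") simp_all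
    then show ?thesis by (subst *[OF j]) (simp split: if_splits)
  qed
  with i(1) show ?thesis by blast
qed

lemma sub_closed_sum:
  fixes \<Lambda> :: "'a::ab_group_add set"
  assumes "0 \<in> \<Lambda>" "\<And>x y. x \<in> \<Lambda> \<Longrightarrow> y \<in> \<Lambda> \<Longrightarrow> x - y \<in> \<Lambda>" "\<And>i. i \<in> I \<Longrightarrow> f i \<in> \<Lambda>"
  shows "sum f I \<in> \<Lambda>"
  using assms(3) by (induction I rule: infinite_finite_induct) (auto intro: assms(1) sub_closed_add[OF assms(1,2)])

lemma int_span_0: "0 \<in> int_span B"
  unfolding int_span_def by (rule range_eqI[where x = "\<lambda>_. 0"]) simp

lemma int_span_diff:
  assumes "x \<in> int_span B" "y \<in> int_span B"
  shows "x - y \<in> int_span B"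
proof -
  obtain c d :: "'a \<Rightarrow> int" where "x = (\<Sum>b\<in>B. of_int (c b) *\<^sub>R b)" "y = (\<Sum>b\<in>B. of_int (d b) *\<^sub>R b)"
    using assms by (auto simp: int_span_def)
  then have "x - y = (\<Sum>b\<in>B. of_int (c b - d b) *\<^sub>R b)"
    by (simp add: sum_subtractf scaleR_diff_left)
  then show ?thesis unfolding int_span_def by (rule range_eqI[where x = "\<lambda>b. c b - d b"])
qed

lemma sub_closed_scale_Ints:
  fixes \<Lambda> :: "'a::real_vector set"
  assumes "0 \<in> \<Lambda>" "\<And>x y. x \<in> \<Lambda> \<Longrightarrow> y \<in> \<Lambda> \<Longrightarrow> x - y \<in> \<Lambda>" "x \<in> \<Lambda>" "k \<in> \<int>"
  shows "k *\<^sub>R x \<in> \<Lambda>"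
  using \<open>k \<in> \<int>\<close> sub_closed_scale[OF assms(1-3)] by (elim Ints_cases) auto

lemma int_span_Basis: "int_span Basis = (int_vecs :: (real ^ 'n) set)"
proof
  show "int_span Basis \<subseteq> (int_vecs :: (real ^ 'n) set)"
  proof (rule sub_closed_int_span[OF int_vecs_0 int_vecs_diff])
    show "Basis \<subseteq> (int_vecs :: (real ^ 'n) set)"
      by (auto simp: int_vecs_def Basis_vec_def axis_def)
  qed auto
  show "int_vecs \<subseteq> (int_span Basis :: (real ^ 'n) set)"
  proof
    fix x :: "real ^ 'n" assume x: "x \<in> int_vecs"
    have "(\<Sum>b\<in>Basis. (x \<bullet> b) *\<^sub>R b) \<in> int_span Basis"
    proof (rule sub_closed_sum[OF int_span_0 int_span_diff])
      fix b :: "real ^ 'n" assume b: "b \<in> Basis"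
      then have "x \<bullet> b \<in> \<int>"
        using x by (auto simp: Basis_vec_def int_vecs_def inner_axis)
      then show "(x \<bullet> b) *\<^sub>R b \<in> int_span Basis"
        using b int_span_superset[OF finite_Basis]
        by (intro sub_closed_scale_Ints[OF int_span_0 int_span_diff]) auto
    qed
    then show "x \<in> int_span Basis" by (simp add: euclidean_representation)
  qed
qed

lemma span_int_vecs: "span int_vecs = (UNIV :: (real ^ 'n) set)"
  by (metis int_span_Basis span_int_span finite_Basis span_Basis)

section \<open>Independence by dual functionals, and isomorphisms from lattice bases\<close>

lemma independent_family:
  fixes e :: "'i \<Rightarrow> 'a::real_vector" and l :: "'i \<Rightarrow> 'a \<Rightarrow> real"
  assumes "finite I" "\<And>i. i \<in> I \<Longrightarrow> linear (l i)"
    and "\<And>i j. i \<in> I \<Longrightarrow> j \<in> I \<Longrightarrow> l i (e j) = (if i = j then 1 else 0)"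
  shows "inj_on e I" "independent (e ` I)"
proof -
  show inj: "inj_on e I"
  proof (rule inj_onI)
    fix i j assume "i \<in> I" "j \<in> I" "e i = e j"
    then show "i = j" using assms(3)[of i i] assms(3)[of i j] by (simp split: if_splits)
  qed
  show "independent (e ` I)"
  proof (rule real_vector.independent_if_scalars_zero)
    show "finite (e ` I)" using assms(1) by simp
    fix f x assume "(\<Sum>x\<in>e ` I. f x *\<^sub>R x) = 0" "x \<in> e ` I"
    then obtain i where i: "i \<in> I" "x = e i" and 0: "(\<Sum>j\<in>I. f (e j) *\<^sub>R e j) = 0"
      using inj by (auto simp: sum.reindex)
    \<comment> \<open>The dual functional \<open>l i\<close> isolates the coefficient of
      \<open>e i\<close>.\<close>
    have "0 = l i (\<Sum>j\<in>I. f (e j) *\<^sub>R e j)" using 0 assms(2)[OF i(1)] by (simp add: linear_0)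
    also have "\<dots> = (\<Sum>j\<in>I. f (e j) * l i (e j))"
      using assms(2)[OF i(1)] by (simp add: linear_sum linear_scale)
    also have "\<dots> = (\<Sum>j\<in>I. if i = j then f (e i) else 0)"
      using assms(3)[OF i(1)] by (intro sum.cong) auto
    also have "\<dots> = f x" using i assms(1) by simp
    finally show "f x = 0" by simp
  qed
qed

text \<open>The linear extension of \<open>\<phi>\<close> is injective because it sends a basis to
  an independent family. The translation by a lattice point \<open>p\<close> is built in so that a
  chosen point of the polytope can be moved to the origin.\<close>

lemma affine_lattice_iso_basis:
  fixes \<phi> :: "real ^ 'n \<Rightarrow> 'b::real_vector"
  assumes B: "finite B" "independent B" "int_span B = int_vecs"
    and \<phi>: "inj_on \<phi> B" "independent (\<phi> ` B)"
  obtains g where "linear g" "\<And>b. b \<in> B \<Longrightarrow> g b = \<phi> b"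
    "\<And>p. p \<in> int_vecs \<Longrightarrow> affine_lattice_iso int_vecs (int_span (\<phi> ` B)) (\<lambda>x. g (x - p))"
proof -
  obtain g where g: "linear g" "\<And>b. b \<in> B \<Longrightarrow> g b = \<phi> b"
    using linear_independent_extend[OF B(2), of \<phi>] by blast
  have gB: "g ` B = \<phi> ` B" "inj_on g B" using g(2) \<phi>(1) by (auto simp: inj_on_def)
  have spB: "span B = UNIV" using span_int_span[OF B(1)] unfolding B(3) span_int_vecs by simp
  have inj: "inj g"
    using linear_inj_on_span_independent_image[OF g(1), of B] gB \<phi>(2) spB by simp
  have gL: "g ` int_vecs = int_span (\<phi> ` B)"
    using int_span_image[OF g(1) gB(2)] B(3) gB(1) by simp
  \<comment> \<open>Translation by \<open>p\<close> permutes \<open>V\<close>; this is applied to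
    the whole space and to the lattice.\<close>
  have shift: "(\<lambda>x. g (x - p)) ` V = g ` V" if "\<And>x. x \<in> V \<Longrightarrow> x - p \<in> V \<and> x + p \<in> V" for p V
  proof -
    have "(\<lambda>x. x - p) ` V = V"
    proof
      show "V \<subseteq> (\<lambda>x. x - p) ` V"
      proof
        fix x assume "x \<in> V"
        then have "x + p \<in> V" using that by blast
        then show "x \<in> (\<lambda>x. x - p) ` V" by (rule rev_image_eqI) simp
      qed
    qed (use that in auto)
    then show ?thesis by (metis image_image)
  qed
  have "affine_lattice_iso int_vecs (int_span (\<phi> ` B)) (\<lambda>x. g (x - p))" if p: "p \<in> int_vecs" for p
    unfolding affine_lattice_iso_def
  proof (intro conjI)
    show "\<exists>h c. linear h \<and> (\<forall>x\<in>span int_vecs. g (x - p) = h x + c)"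
      using g(1) by (intro exI[of _ g] exI[of _ "- g p"]) (simp add: linear_diff)
    have "span (int_span (\<phi> ` B)) = range g"
      unfolding gL[symmetric] by (simp add: linear_span_image g(1) span_int_vecs)
    moreover have "inj (\<lambda>x. g (x - p))" using inj by (auto intro!: injI dest: injD)
    ultimately show "bij_betw (\<lambda>x. g (x - p)) (span int_vecs) (span (int_span (\<phi> ` B)))"
      using shift[of UNIV p] unfolding span_int_vecs bij_betw_def by simp
    show "(\<lambda>x. g (x - p)) ` int_vecs = int_span (\<phi> ` B)"
      unfolding gL[symmetric]
      using p by (intro shift conjI int_vecs_diff sub_closed_add[OF int_vecs_0 int_vecs_diff])
  qed
  with g that show ?thesis by blast
qed

lemma affine_image_convex_hull:
  assumes "linear g"
  shows "(\<lambda>x. g (x - p)) ` (convex hull S) = convex hull ((\<lambda>x. g (x - p)) ` S)"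
proof -
  have *: "(\<lambda>x. g (x - p)) ` V = (+) (- g p) ` (g ` V)" for V
    using assms by (simp add: image_image linear_diff)
  show ?thesis
    unfolding * convex_hull_translation convex_hull_linear_image[OF assms] ..
qed

section \<open>Cayley sums from decompositions of the constant 1\<close>

text \<open>The pair \<open>(a, b)\<close> stands for the affine function \<open>x \<mapsto> a \<bullet> x + b\<close>, whose value at \<open>x\<close> is
  \<open>(a, b) \<bullet> (x, 1)\<close>. Each point of \<open>S\<close> is integral, so exactly one of the functions is 1 there,
  and the functions partition \<open>S\<close> into the layers of a Cayley sum.\<close>

locale unit_decomposition =
  fixes S :: "(real ^ 'n) set" and t :: nat and w :: "nat \<Rightarrow> (real ^ 'n) \<times> real"
  assumes finite_S: "finite S" and S_int: "S \<subseteq> int_vecs"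
    and full: "\<And>u :: (real ^ 'n) \<times> real. (\<And>p. p \<in> S \<Longrightarrow> u \<bullet> (p, 1) = 0) \<Longrightarrow> u = 0"
    and w_int: "\<And>i. i \<le> t \<Longrightarrow> w i \<in> int_vecs \<times> \<int>"
    and w_nonneg: "\<And>i p. i \<le> t \<Longrightarrow> p \<in> S \<Longrightarrow> 0 \<le> w i \<bullet> (p, 1)"
    and w_nonzero: "\<And>i. i \<le> t \<Longrightarrow> w i \<noteq> 0"
    and w_sum: "(\<Sum>i\<le>t. w i) = (0, 1)"
begin

lemma layer_exists:
  assumes "p \<in> S" shows "\<exists>i\<le>t. \<forall>j\<le>t. w j \<bullet> (p, 1) = (if j = i then 1 else 0)"
proof (rule unit_sum_cases)
  have "p \<in> int_vecs" using S_int assms by blast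
  then show "w i \<bullet> (p, 1) \<in> \<int>" if "i \<le> t" for i
    using w_int[OF that] by (auto simp: inner_prod_def int_vecs_inner)
  show "(\<Sum>i\<le>t. w i \<bullet> (p, 1)) = 1"
    by (simp flip: inner_sum_left add: w_sum)
qed (use w_nonneg assms in auto)

text \<open>A nonzero affine function cannot vanish on all of \<open>S\<close>. At a point where
  \<open>w i\<close> does not vanish, the one function with value 1 must be
  \<open>w i\<close>.\<close>

lemma layer_nonempty:
  assumes i: "i \<le> t" shows "\<exists>p. p \<in> S \<and> (\<forall>j\<le>t. w j \<bullet> (p, 1) = (if j = i then 1 else 0))"
proof -
  obtain p where p: "p \<in> S" "w i \<bullet> (p, 1) \<noteq> 0"
    using full[of "w i"] w_nonzero[OF i] by blast
  from layer_exists[OF p(1)] obtain k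
    where k: "k \<le> t" "\<And>j. j \<le> t \<Longrightarrow> w j \<bullet> (p, 1) = (if j = k then 1 else 0)" by blast
  from k(2)[OF i] p(2) have "k = i" by (simp split: if_splits)
  with p(1) k show ?thesis by blast
qed

text \<open>A representative of layer \<open>i\<close>. Any choice works: only its membership in
  \<open>S\<close> and the values of the functions \<open>w j\<close> at it are used.\<close>

definition vert :: "nat \<Rightarrow> real ^ 'n" where
  "vert i = (SOME p. p \<in> S \<and> (\<forall>j\<le>t. w j \<bullet> (p, 1) = (if j = i then 1 else 0)))"

lemma vert:
  assumes "i \<le> t"
  shows vert_S: "vert i \<in> S" and w_vert: "\<And>j. j \<le> t \<Longrightarrow> w j \<bullet> (vert i, 1) = (if j = i then 1 else 0)"
  using someI_ex[OF layer_nonempty[OF assms]] unfolding vert_def by auto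

definition edge :: "nat \<Rightarrow> real ^ 'n" where
  "edge i = vert i - vert 0"

lemma inner_diff_eq: "fst (w j) \<bullet> (x - y) = w j \<bullet> (x, 1) - w j \<bullet> (y, 1)"
  by (simp add: inner_prod_def inner_diff_right)

text \<open>Edges and linear parts are dual families. Index 0 is left out on both sides:
  \<open>vert 0\<close> is the base point, and the linear parts sum to 0, so that of
  \<open>w 0\<close> is determined by the others.\<close>

lemma inner_edge:
  assumes "i \<in> {1..t}" "j \<in> {1..t}"
  shows "fst (w j) \<bullet> edge i = (if j = i then 1 else 0)"
  using assms by (simp add: edge_def inner_diff_eq w_vert)

lemma edge_int: "i \<le> t \<Longrightarrow> edge i \<in> int_vecs"
  using vert_S S_int by (auto simp: edge_def intro!: int_vecs_diff)

lemma inj_edge: "inj_on edge {1..t}"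
proof (rule inj_onI)
  fix i j assume "i \<in> {1..t}" "j \<in> {1..t}" "edge i = edge j"
  then show "i = j" using inner_edge[of i i] inner_edge[of j i] by (simp split: if_splits)
qed

text \<open>The edges split the map given by the linear parts of the functions, so that a lattice basis
  of its kernel extends by the edges to one of \<open>\<int>\<^sup>n\<close>.\<close>

lemma lattice_basis:
  obtains B where "finite B" "B \<inter> edge ` {1..t} = {}" "card B + t = CARD('n)"
    "independent (B \<union> edge ` {1..t})" "int_span (B \<union> edge ` {1..t}) = int_vecs"
    "\<forall>b\<in>B. \<forall>j\<in>{1..t}. fst (w j) \<bullet> b = 0"
    "int_span B = {x \<in> int_vecs. \<forall>j\<in>{1..t}. fst (w j) \<bullet> x = 0}"
proof -
  define K where "K = {x \<in> int_vecs. \<forall>j\<in>{1..t}. fst (w j) \<bullet> x = 0}"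
  have "\<exists>B. finite B \<and> independent B \<and> int_span B = K"
    by (rule int_subgroup_basis[of UNIV])
      (auto simp: K_def inner_diff_right int_vecs_0 intro: int_vecs_diff)
  then obtain B where B: "finite B" "independent B" "int_span B = K" by blast
  have BK: "B \<subseteq> K" using int_span_superset[OF B(1)] B(3) by simp
  then have orth: "fst (w j) \<bullet> b = 0" if "b \<in> B" "j \<in> {1..t}" for b j
    using that by (auto simp: K_def)
  have disj: "B \<inter> edge ` {1..t} = {}"
  proof -
    have False if "b \<in> B" "b = edge j" "j \<in> {1..t}" for b j
      using orth[OF that(1,3)] inner_edge[OF that(3,3)] that(2) by simp
    then show ?thesis by blast
  qed
  let ?B = "B \<union> edge ` {1..t}"
  have fin: "finite ?B" using B(1) by simp
  have indep: "independent ?B"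
  proof (rule real_vector.independent_if_scalars_zero[OF fin])
    fix f x assume 0: "(\<Sum>x\<in>?B. f x *\<^sub>R x) = 0" and x: "x \<in> ?B"
    have split: "(\<Sum>x\<in>?B. f x *\<^sub>R x) = (\<Sum>x\<in>B. f x *\<^sub>R x) + (\<Sum>i\<in>{1..t}. f (edge i) *\<^sub>R edge i)"
      using B(1) disj inj_edge by (simp add: sum.union_disjoint sum.reindex)
    \<comment> \<open>By duality the linear part of \<open>w j\<close> kills \<open>B\<close> and
      all edges but \<open>edge j\<close>.\<close>
    have fe: "f (edge j) = 0" if j: "j \<in> {1..t}" for j
    proof -
      have "0 = fst (w j) \<bullet> (\<Sum>x\<in>?B. f x *\<^sub>R x)" using 0 by simp
      also have "\<dots> = (\<Sum>x\<in>B. f x * (fst (w j) \<bullet> x)) + (\<Sum>i\<in>{1..t}. f (edge i) * (fst (w j) \<bullet> edge i))"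
        unfolding split by (simp add: inner_add_right inner_sum_right)
      also have "(\<Sum>x\<in>B. f x * (fst (w j) \<bullet> x)) = 0"
        using orth j by (intro sum.neutral) auto
      also have "(\<Sum>i\<in>{1..t}. f (edge i) * (fst (w j) \<bullet> edge i)) = (\<Sum>i\<in>{1..t}. if j = i then f (edge i) else 0)"
        using inner_edge j by (intro sum.cong) auto
      also have "\<dots> = f (edge j)" using j by simp
      finally show ?thesis by simp
    qed
    have "(\<Sum>x\<in>B. f x *\<^sub>R x) = 0"
      using 0 fe unfolding split by simp
    then have "f x = 0" if "x \<in> B" for x
      using independentD[OF B(2) B(1) order_refl] that by blast
    with fe x show "f x = 0" by blast
  qed
  have span: "int_span ?B = int_vecs"
  proof
    show "int_span ?B \<subseteq> int_vecs"
      using BK edge_int fin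
      by (intro sub_closed_int_span[OF int_vecs_0 int_vecs_diff]) (auto simp: K_def)
    have K_sub: "K \<subseteq> int_span ?B"
      unfolding B(3)[symmetric] using B(1) int_span_superset[OF fin]
      by (intro sub_closed_int_span[OF int_span_0 int_span_diff]) auto
    show "int_vecs \<subseteq> int_span ?B"
    proof
      fix x :: "real ^ 'n" assume x: "x \<in> int_vecs"
      \<comment> \<open>\<open>?y\<close> is the edge component of \<open>x\<close>: the linear
        parts agree on \<open>x\<close> and \<open>?y\<close>, so \<open>x - ?y\<close> lies in the
        kernel \<open>K\<close>.\<close>
      let ?y = "\<Sum>i\<in>{1..t}. (fst (w i) \<bullet> x) *\<^sub>R edge i"
      have Z: "fst (w i) \<bullet> x \<in> \<int>" if "i \<in> {1..t}" for i
        using w_int[of i] that x int_vecs_inner by auto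
      have y: "?y \<in> int_span ?B"
        using Z int_span_superset[OF fin]
        by (intro sub_closed_sum[OF int_span_0 int_span_diff]
            sub_closed_scale_Ints[OF int_span_0 int_span_diff]) auto
      have "fst (w j) \<bullet> ?y = fst (w j) \<bullet> x" if j: "j \<in> {1..t}" for j
      proof -
        have "fst (w j) \<bullet> ?y = (\<Sum>i\<in>{1..t}. (fst (w i) \<bullet> x) * (fst (w j) \<bullet> edge i))"
          by (simp add: inner_sum_right)
        also have "\<dots> = (\<Sum>i\<in>{1..t}. if j = i then fst (w i) \<bullet> x else 0)"
          using inner_edge j by (intro sum.cong) auto
        also have "\<dots> = fst (w j) \<bullet> x" using j by simp
        finally show ?thesis .
      qed
      moreover have "?y \<in> int_vecs"
        using Z edge_int
        by (intro sub_closed_sum[OF int_vecs_0 int_vecs_diff]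
            sub_closed_scale_Ints[OF int_vecs_0 int_vecs_diff]) auto
      ultimately have "x - ?y \<in> K"
        using x int_vecs_diff by (auto simp: K_def inner_diff_right)
      then have "(x - ?y) + ?y \<in> int_span ?B"
        using K_sub y by (intro sub_closed_add[OF int_span_0 int_span_diff]) auto
      then show "x \<in> int_span ?B" by simp
    qed
  qed
  have "span ?B = UNIV"
    using span_int_span[OF fin] unfolding span span_int_vecs by simp
  then have "card ?B = CARD('n)"
    using dim_eq_card[of ?B UNIV] indep by (simp add: dim_UNIV)
  then have "card B + t = CARD('n)"
    using disj B(1) inj_edge by (simp add: card_Un_disjoint card_image)
  show ?thesis
    using that[OF B(1) disj \<open>card B + t = _\<close> indep span] orth B(3) unfolding K_def by blast
qed

lemma card_le: "t \<le> CARD('n)"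
  by (rule lattice_basis) simp

text \<open>For \<open>t = n\<close> the linear parts have no common kernel, so every layer is a
  single point and the edges form a lattice basis. This is the case excluded by the assumption that
  \<open>P\<close> is not a standard simplex.\<close>

lemma simplex:
  assumes "t = CARD('n)"
  shows "lattice_equiv int_vecs (convex hull S) int_vecs (std_simplex :: (real ^ 'n) set)"
proof -
  obtain B where B: "finite B" "card B + t = CARD('n)"
    "independent (B \<union> edge ` {1..t})" "int_span (B \<union> edge ` {1..t}) = int_vecs"
    "int_span B = {x \<in> int_vecs. \<forall>j\<in>{1..t}. fst (w j) \<bullet> x = 0}"
    by (rule lattice_basis)
  have [simp]: "B = {}" using B(1,2) assms by simp
  let ?D = "edge ` {1..t}"
  have "card ?D = card (Basis :: (real ^ 'n) set)"
    using inj_edge assms by (simp add: card_image)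
  \<comment> \<open>Any bijection serves, since the standard simplex is symmetric in the unit
    vectors.\<close>
  then obtain \<phi> where \<phi>: "bij_betw \<phi> ?D (Basis :: (real ^ 'n) set)"
    using finite_same_card_bij[of ?D "Basis :: (real ^ 'n) set"] by auto
  then have im: "\<phi> ` ?D = Basis" "inj_on \<phi> ?D" by (auto simp: bij_betw_def)
  obtain g where g: "linear g" "\<And>b. b \<in> ?D \<Longrightarrow> g b = \<phi> b"
    "\<And>p. p \<in> int_vecs \<Longrightarrow> affine_lattice_iso int_vecs (int_span (\<phi> ` ?D)) (\<lambda>x. g (x - p))"
    using affine_lattice_iso_basis[of ?D \<phi>] B(3,4) im independent_Basis by auto
  let ?f = "\<lambda>x. g (x - vert 0)"
  have S_eq: "S = vert ` {..t}"
  proof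
    show "S \<subseteq> vert ` {..t}"
    proof
      fix p assume p: "p \<in> S"
      from layer_exists[OF p] obtain i
        where i: "i \<le> t" "\<And>j. j \<le> t \<Longrightarrow> w j \<bullet> (p, 1) = (if j = i then 1 else 0)" by blast
      \<comment> \<open>All linear parts vanish on the difference of two points of one layer; as
        \<open>B\<close> is empty, the difference is 0.\<close>
      have "p - vert i \<in> int_span B"
        unfolding B(5) using p i vert_S[OF i(1)] S_int
        by (auto simp: inner_diff_eq w_vert intro!: int_vecs_diff)
      then have "p = vert i" by (simp add: int_span_def)
      with i(1) show "p \<in> vert ` {..t}" by blast
    qed
  qed (use vert_S in auto)
  have "{..t} = insert 0 {1..t}" by auto
  with S_eq have "S = insert (vert 0) (vert ` {1..t})" by simp
  then have "?f ` S = ?f ` insert (vert 0) (vert ` {1..t})" by (rule arg_cong)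
  also have "\<dots> = insert (g 0) (g ` ?D)"
    by (simp add: image_image edge_def)
  also have "g 0 = 0" using g(1) by (rule linear_0)
  also have "g ` ?D = Basis" using g(2) im(1) by (metis image_cong)
  finally have "?f ` (convex hull S) = std_simplex"
    unfolding affine_image_convex_hull[OF g(1)] std_simplex_def by simp
  moreover have "affine_lattice_iso int_vecs int_vecs ?f"
    using g(3)[of "vert 0"] im(1) vert_S[of 0] S_int by (auto simp: int_span_Basis)
  ultimately show ?thesis unfolding lattice_equiv_def by blast
qed

end

section \<open>Coordinates for the ambient space of a Cayley sum\<close>

lemma lookup_scaleR [simp]:
  "Poly_Mapping.lookup (r *\<^sub>R x) i = r *\<^sub>R Poly_Mapping.lookup (x :: 'a \<Rightarrow>\<^sub>0 'b::real_vector) i"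
proof -
  have "finite {i. r *\<^sub>R Poly_Mapping.lookup x i \<noteq> 0}"
    by (rule finite_subset[OF _ finite_lookup[of x]]) auto
  then show ?thesis unfolding scaleR_poly_mapping_def by simp
qed

lemma int_vecs_dim_0: "0 \<in> int_vecs_dim m"
  by (simp add: int_vecs_dim_def)

lemma int_vecs_dim_diff:
  "x \<in> int_vecs_dim m \<Longrightarrow> y \<in> int_vecs_dim m \<Longrightarrow> x - y \<in> int_vecs_dim m"
  using keys_diff[of x y] by (auto simp: int_vecs_dim_def lookup_minus)

lemma single_int_vecs_dim: "j \<in> {1..m} \<Longrightarrow> Poly_Mapping.single j 1 \<in> int_vecs_dim m"
  by (auto simp: int_vecs_dim_def lookup_single when_def)

text \<open>The standard basis of the product space, with \<open>Inl\<close> indexing the first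
  factor and \<open>Inr\<close> the second, so that a basis of both kinds of vectors is matched by
  one map.\<close>

definition unit_pair :: "nat + nat \<Rightarrow> (nat \<Rightarrow>\<^sub>0 real) \<times> (nat \<Rightarrow>\<^sub>0 real)" where
  "unit_pair = case_sum (\<lambda>j. (Poly_Mapping.single j 1, 0)) (\<lambda>i. (0, Poly_Mapping.single i 1))"

lemma unit_pair_independent:
  assumes "finite I" shows "inj_on unit_pair I" "independent (unit_pair ` I)"
proof -
  define l where "l = case_sum (\<lambda>j z :: (nat \<Rightarrow>\<^sub>0 real) \<times> (nat \<Rightarrow>\<^sub>0 real). Poly_Mapping.lookup (fst z) j)
    (\<lambda>i z. Poly_Mapping.lookup (snd z) i)"
  have lin: "linear (l i)" for i
    by (auto intro!: linearI simp: l_def lookup_add split: sum.splits)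
  have dual: "l i (unit_pair j) = (if i = j then 1 else 0)" for i j
    by (auto simp: l_def unit_pair_def lookup_single when_def split: sum.splits)
  show "inj_on unit_pair I" "independent (unit_pair ` I)"
    using independent_family[of I l unit_pair] assms lin dual by auto
qed

lemma poly_mapping_eq_sum_single:
  assumes "Poly_Mapping.keys x \<subseteq> I" "finite I"
  shows "x = (\<Sum>i\<in>I. Poly_Mapping.lookup x i *\<^sub>R Poly_Mapping.single i (1 :: real))"
proof (rule poly_mapping_eqI)
  fix k
  have "(\<Sum>i\<in>I. Poly_Mapping.lookup x i * (1 when i = k)) = (\<Sum>i\<in>I. if i = k then Poly_Mapping.lookup x k else 0)"
    by (intro sum.cong) auto
  also have "\<dots> = Poly_Mapping.lookup x k"
    using assms by (auto simp: in_keys_iff)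
  finally show "Poly_Mapping.lookup x k = Poly_Mapping.lookup (\<Sum>i\<in>I. Poly_Mapping.lookup x i *\<^sub>R Poly_Mapping.single i 1) k"
    by (simp add: lookup_sum lookup_single)
qed

lemma int_span_unit_pair:
  "int_span (unit_pair ` ({1..m} <+> {1..t})) = int_vecs_dim m \<times> int_vecs_dim t" (is "int_span ?E = ?M")
proof
  have fin: "finite ?E" by simp
  have M0: "0 \<in> ?M" by (simp add: int_vecs_dim_0 zero_prod_def)
  have Md: "x \<in> ?M \<Longrightarrow> y \<in> ?M \<Longrightarrow> x - y \<in> ?M" for x y
    by (auto simp: int_vecs_dim_diff)
  show "int_span ?E \<subseteq> ?M"
    by (intro sub_closed_int_span[OF M0 Md])
      (auto simp: unit_pair_def int_vecs_dim_0 intro!: single_int_vecs_dim)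
  show "?M \<subseteq> int_span ?E"
  proof clarify
    fix x y assume xy: "x \<in> int_vecs_dim m" "y \<in> int_vecs_dim t"
    let ?x = "\<Sum>j\<in>{1..m}. Poly_Mapping.lookup x j *\<^sub>R unit_pair (Inl j)"
    let ?y = "\<Sum>i\<in>{1..t}. Poly_Mapping.lookup y i *\<^sub>R unit_pair (Inr i)"
    have mem: "unit_pair i \<in> int_span ?E" if "i \<in> {1..m} <+> {1..t}" for i
      using that int_span_superset[OF fin] by blast
    have "?x + ?y \<in> int_span ?E"
      by (intro sub_closed_add[OF int_span_0 int_span_diff] sub_closed_sum[OF int_span_0 int_span_diff]
          sub_closed_scale_Ints[OF int_span_0 int_span_diff] mem)
        (use xy in \<open>auto simp: int_vecs_dim_def\<close>)
    also have "?x + ?y = (x, y)"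
    proof (rule prod_eqI)
      show "fst (?x + ?y) = fst (x, y)"
        using poly_mapping_eq_sum_single[of x "{1..m}"] xy(1)
        by (simp add: fst_sum unit_pair_def int_vecs_dim_def)
      show "snd (?x + ?y) = snd (x, y)"
        using poly_mapping_eq_sum_single[of y "{1..t}"] xy(2)
        by (simp add: snd_sum unit_pair_def int_vecs_dim_def)
    qed
    finally show "(x, y) \<in> int_span ?E" .
  qed
qed

text \<open>Bridges two descriptions of the Cayley sum: as the hull of polytopes, and as the hull of
  the finitely many image points of \<open>S\<close>.\<close>

lemma convex_hull_UN_convex_hull:
  "convex hull (\<Union>i\<in>I. convex hull A i) = convex hull (\<Union>i\<in>I. A i)"
proof (rule hull_unique)
  show "(\<Union>i\<in>I. convex hull A i) \<subseteq> convex hull (\<Union>i\<in>I. A i)"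
    by (intro UN_least hull_mono) auto
  fix T assume "(\<Union>i\<in>I. convex hull A i) \<subseteq> T" "convex T"
  then show "convex hull (\<Union>i\<in>I. A i) \<subseteq> T"
    by (intro hull_minimal) (use hull_subset in fastforce)+
qed (rule convex_convex_hull)

context unit_decomposition begin

text \<open>The kernel basis is sent to the unit vectors of the first factor and the edges to those
  of the second. The second component then records the values of the linear parts, hence the layer,
  and the first components of the layers span the summands.\<close>

lemma cayley:
  assumes m: "m + t = CARD('n)"
  shows "\<exists>Q. (\<forall>i\<in>{0..t}. lattice_polytope (int_vecs_dim m) (Q i)) \<and>
    lattice_equiv int_vecs (convex hull S) (int_vecs_dim m \<times> int_vecs_dim t) (cayley_sum t Q)"
proof -
  obtain B where B: "finite B" "B \<inter> edge ` {1..t} = {}" "card B + t = CARD('n)"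
    "independent (B \<union> edge ` {1..t})" "int_span (B \<union> edge ` {1..t}) = int_vecs"
    "\<forall>b\<in>B. \<forall>j\<in>{1..t}. fst (w j) \<bullet> b = 0"
    "int_span B = {x \<in> int_vecs. \<forall>j\<in>{1..t}. fst (w j) \<bullet> x = 0}"
    by (rule lattice_basis)
  have "card B = m" using B(3) m by simp
  then obtain h where h: "bij_betw h {1..m} B"
    using finite_same_card_bij[of "{1..m}" B] B(1) by auto
  let ?B = "B \<union> edge ` {1..t}" and ?I = "{1..m} <+> {1..t}"
  have finB: "finite ?B" using B(1) by simp
  define b where "b = case_sum h edge"
  have h': "inj_on h {1..m}" "h ` {1..m} = B" using h by (auto simp: bij_betw_def)
  have b_im: "b ` ?I = ?B"
    unfolding Plus_def image_Un image_image b_def using h'(2) by simp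
  have b_inj: "inj_on b ?I"
  proof (rule inj_onI)
    fix i j assume "i \<in> ?I" "j \<in> ?I" "b i = b j"
    moreover have "h k \<noteq> edge l" if "k \<in> {1..m}" "l \<in> {1..t}" for k l
      using B(2) h'(2) that by blast
    ultimately show "i = j"
      using inj_onD[OF h'(1)] inj_onD[OF inj_edge] unfolding b_def
      by (elim PlusE; simp only: sum.case; metis)
  qed
  define \<phi> where "\<phi> = unit_pair \<circ> the_inv_into ?I b"
  have \<phi>b: "\<phi> (b i) = unit_pair i" if "i \<in> ?I" for i
    using the_inv_into_f_f[OF b_inj that] by (simp add: \<phi>_def)
  have \<phi>_im: "\<phi> ` ?B = unit_pair ` ?I"
    unfolding b_im[symmetric] image_image using \<phi>b by (rule image_cong[OF refl])
  have \<phi>_inj: "inj_on \<phi> ?B"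
  proof -
    have "inj_on (the_inv_into ?I b) ?B"
      using inj_on_the_inv_into[OF b_inj] unfolding b_im .
    moreover have "the_inv_into ?I b ` ?B = ?I"
      using the_inv_into_onto[OF b_inj] unfolding b_im .
    ultimately show ?thesis
      unfolding \<phi>_def using unit_pair_independent(1)[of ?I] by (intro comp_inj_on) auto
  qed
  let ?M = "int_vecs_dim m \<times> int_vecs_dim t"
  have \<phi>_ind: "independent (\<phi> ` ?B)"
    unfolding \<phi>_im by (intro unit_pair_independent) simp
  obtain g where g: "linear g" "\<And>x. x \<in> ?B \<Longrightarrow> g x = \<phi> x"
    "\<And>p. p \<in> int_vecs \<Longrightarrow> affine_lattice_iso int_vecs (int_span (\<phi> ` ?B)) (\<lambda>x. g (x - p))"
    using affine_lattice_iso_basis[OF finB B(4,5) \<phi>_inj \<phi>_ind] by blast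
  define f where "f = (\<lambda>x. g (x - vert 0))"
  have iso: "affine_lattice_iso int_vecs ?M f"
    using g(3)[of "vert 0"] vert_S[of 0] S_int unfolding f_def \<phi>_im int_span_unit_pair by auto
  \<comment> \<open>Both sides are linear in \<open>x\<close>, so they are compared on the lattice
    basis: kernel vectors give 0, and \<open>edge k\<close> gives the \<open>k\<close>-th unit
    vector.\<close>
  have snd_g: "snd (g x) = (\<Sum>j\<in>{1..t}. (fst (w j) \<bullet> x) *\<^sub>R Poly_Mapping.single j 1)" for x
  proof (rule linear_eq_on[where B = ?B and f = "\<lambda>x. snd (g x)"])
    show "linear (\<lambda>x. snd (g x))"
      using linear_compose[OF g(1) linear_snd] by (simp add: o_def)
    show "linear (\<lambda>x. \<Sum>j\<in>{1..t}. (fst (w j) \<bullet> x) *\<^sub>R Poly_Mapping.single j (1::real))"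
      by (auto intro!: linearI simp: inner_add_right scaleR_add_left sum.distrib scaleR_sum_right)
    show "x \<in> span ?B"
      using span_int_span[OF finB] unfolding B(5) span_int_vecs by simp
    fix y assume "y \<in> ?B"
    then obtain i where i: "i \<in> ?I" "y = b i" using b_im by blast
    then have gy: "g y = unit_pair i" using g(2) \<phi>b \<open>y \<in> ?B\<close> by metis
    show "snd (g y) = (\<Sum>j\<in>{1..t}. (fst (w j) \<bullet> y) *\<^sub>R Poly_Mapping.single j 1)"
    proof (cases i)
      case (Inl k)
      then have "y \<in> B" using i h by (auto simp: b_def bij_betw_def)
      then have "(\<Sum>j\<in>{1..t}. (fst (w j) \<bullet> y) *\<^sub>R Poly_Mapping.single j (1::real)) = 0"
        using B(6) by (intro sum.neutral) auto
      then show ?thesis unfolding gy by (simp add: Inl unit_pair_def)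
    next
      case (Inr k)
      then have k: "k \<in> {1..t}" "y = edge k" using i by (auto simp: b_def)
      have "(\<Sum>j\<in>{1..t}. (fst (w j) \<bullet> y) *\<^sub>R Poly_Mapping.single j (1::real)) =
          (\<Sum>j\<in>{1..t}. if j = k then Poly_Mapping.single k 1 else 0)"
        unfolding k(2) using inner_edge[OF k(1)] by (intro sum.cong) auto
      also have "\<dots> = Poly_Mapping.single k 1" using k(1) by simp
      finally show ?thesis unfolding gy by (simp add: Inr unit_pair_def)
    qed
  qed
  define layer where "layer = (\<lambda>i. {p \<in> S. \<forall>j\<le>t. w j \<bullet> (p, 1) = (if j = i then 1 else 0)})"
  \<comment> \<open>Subtracting \<open>vert 0\<close> changes nothing here, because
    \<open>w j\<close> vanishes at \<open>vert 0\<close> for \<open>j \<ge> 1\<close>.\<close>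
  have snd_f: "snd (f p) = cayley_vertex i" if p: "p \<in> layer i" and i: "i \<le> t" for p i
  proof -
    have "snd (f p) = (\<Sum>j\<in>{1..t}. if j = i then Poly_Mapping.single i 1 else 0)"
      unfolding f_def snd_g inner_diff_eq using p i
      by (intro sum.cong) (auto simp: layer_def w_vert)
    also have "\<dots> = cayley_vertex i"
      using i by (auto simp: cayley_vertex_def)
    finally show ?thesis .
  qed
  have S_layers: "S = (\<Union>i\<in>{0..t}. layer i)"
    using layer_exists by (fastforce simp: layer_def)
  have f_M: "f p \<in> ?M" if "p \<in> S" for p
    using iso S_int that unfolding affine_lattice_iso_def by blast
  define A where "A = (\<lambda>i. fst ` f ` layer i)"
  \<comment> \<open>The second component is constant on a layer, so the image of a layer is a
    product.\<close>
  have f_layer: "f ` layer i = A i \<times> {cayley_vertex i}" if "i \<le> t" for i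
  proof (intro equalityI subsetI)
    fix z assume "z \<in> f ` layer i"
    then show "z \<in> A i \<times> {cayley_vertex i}"
      using snd_f[OF _ that] by (auto simp: A_def mem_Times_iff)
  next
    fix z assume z: "z \<in> A i \<times> {cayley_vertex i}"
    then obtain p where p: "p \<in> layer i" "fst z = fst (f p)"
      by (auto simp: A_def mem_Times_iff)
    then have "z = f p" using z snd_f[OF _ that] by (auto simp: mem_Times_iff prod_eq_iff)
    with p(1) show "z \<in> f ` layer i" by blast
  qed
  define Q where "Q = (\<lambda>i. convex hull A i)"
  have "lattice_polytope (int_vecs_dim m) (Q i)" if i: "i \<in> {0..t}" for i
    unfolding lattice_polytope_def
  proof (intro exI conjI)
    show "Q i = convex hull (A i)" by (simp add: Q_def)
    show "finite (A i)" using finite_S by (simp add: A_def layer_def)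
    show "A i \<noteq> {}" using layer_nonempty[of i] i by (auto simp: A_def layer_def)
    show "A i \<subseteq> int_vecs_dim m"
    proof
      fix x assume "x \<in> A i"
      then obtain p where "p \<in> S" "x = fst (f p)" by (auto simp: A_def layer_def)
      then show "x \<in> int_vecs_dim m" using f_M[of p] by (simp add: mem_Times_iff)
    qed
  qed
  moreover have "f ` (convex hull S) = cayley_sum t Q"
  proof -
    have "f ` (convex hull S) = convex hull (f ` S)"
      unfolding f_def by (rule affine_image_convex_hull[OF g(1)])
    also have "f ` S = (\<Union>i\<in>{0..t}. f ` layer i)"
      using arg_cong[OF S_layers, of "image f"] by (simp add: image_UN)
    also have "\<dots> = (\<Union>i\<in>{0..t}. A i \<times> {cayley_vertex i})"
      using f_layer by (intro SUP_cong) auto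
    also have "convex hull \<dots> = convex hull (\<Union>i\<in>{0..t}. convex hull (A i \<times> {cayley_vertex i}))"
      by (rule convex_hull_UN_convex_hull[symmetric])
    also have "\<dots> = cayley_sum t Q"
      by (simp add: cayley_sum_def Q_def convex_hull_Times)
    finally show ?thesis .
  qed
  ultimately show ?thesis
    using iso unfolding lattice_equiv_def by blast
qed

end

section \<open>Rounding a conic combination\<close>

text \<open>Caratheodory's exchange, performed in the direction that does not decrease the total weight.\<close>

lemma independent_nonneg_combination:
  fixes U :: "'a::real_vector set" and c :: "'a \<Rightarrow> real"
  assumes "finite U" "\<And>u. u \<in> U \<Longrightarrow> 0 \<le> c u"
    and "\<And>d. (\<And>u. u \<in> U \<Longrightarrow> 0 \<le> d u) \<Longrightarrow> (\<Sum>u\<in>U. d u *\<^sub>R u) = 0 \<Longrightarrow> (\<forall>u\<in>U. d u = 0)"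
  shows "\<exists>V c'. V \<subseteq> U \<and> independent V \<and> (\<forall>u\<in>V. 0 \<le> c' u) \<and>
    (\<Sum>u\<in>V. c' u *\<^sub>R u) = (\<Sum>u\<in>U. c u *\<^sub>R u) \<and> sum c U \<le> sum c' V"
  using assms
proof (induction U arbitrary: c rule: finite_psubset_induct)
  case (psubset U)
  note pointed = psubset.prems(2)
  show ?case
  proof (cases "independent U")
    case True
    then show ?thesis using psubset.prems(1) by (intro exI[of _ U] exI[of _ c]) auto
  next
    case False
    then obtain d0 where d0: "\<exists>v\<in>U. d0 v \<noteq> 0" "(\<Sum>v\<in>U. d0 v *\<^sub>R v) = 0"
      using real_vector.dependent_finite[OF psubset.hyps(1)] by blast
    \<comment> \<open>The sign is chosen so that moving along \<open>d\<close> does not lower the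
      total weight.\<close>
    define d where "d = (if sum d0 U \<ge> 0 then d0 else (\<lambda>u. - d0 u))"
    have d: "\<exists>v\<in>U. d v \<noteq> 0" "(\<Sum>v\<in>U. d v *\<^sub>R v) = 0" "0 \<le> sum d U"
      using d0 by (auto simp: d_def sum_negf)
    define N where "N = {u \<in> U. d u < 0}"
    \<comment> \<open>Pointedness rules out a nonnegative nontrivial relation, so the move must end
      at a vanishing coefficient.\<close>
    have "N \<noteq> {}"
    proof
      assume "N = {}"
      then have "\<forall>u\<in>U. 0 \<le> d u" by (auto simp: N_def not_less)
      with pointed[of d] d(1,2) show False by blast
    qed
    moreover have "finite N" using psubset.hyps(1) by (simp add: N_def)
    ultimately obtain v where v: "v \<in> N" "\<And>u. u \<in> N \<Longrightarrow> c v / (- d v) \<le> c u / (- d u)"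
      using arg_min_if_finite[of N "\<lambda>u. c u / (- d u)"] by (metis not_less)
    \<comment> \<open>The longest step that keeps all coefficients nonnegative; it makes the
      coefficient of \<open>v\<close> zero.\<close>
    define \<tau> where "\<tau> = c v / (- d v)"
    have vU: "v \<in> U" "d v < 0" using v(1) by (auto simp: N_def)
    have \<tau>: "0 \<le> \<tau>" using psubset.prems(1)[OF vU(1)] vU(2) by (simp add: \<tau>_def divide_nonneg_neg)
    define c' where "c' = (\<lambda>u. c u + \<tau> * d u)"
    have c'v: "c' v = 0" using vU(2) by (simp add: c'_def \<tau>_def)
    have c'_nonneg: "0 \<le> c' u" if u: "u \<in> U" for u
    proof (cases "d u < 0")
      case True
      then have "\<tau> \<le> c u / (- d u)" using v(2)[of u] u by (simp add: N_def \<tau>_def)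
      then have "\<tau> * (- d u) \<le> c u" using True by (simp only: pos_le_divide_eq neg_0_less_iff_less)
      then show ?thesis by (simp add: c'_def)
    next
      case False
      then show ?thesis using \<tau> psubset.prems(1)[OF u] by (simp add: c'_def)
    qed
    have rem: "sum f (U - {v}) = sum f U" if "f v = 0" for f :: "'a \<Rightarrow> 'b::ab_group_add"
      using that psubset.hyps(1) vU(1) by (simp add: sum_diff1)
    have eq: "(\<Sum>u\<in>U - {v}. c' u *\<^sub>R u) = (\<Sum>u\<in>U. c u *\<^sub>R u)"
    proof -
      have "(\<Sum>u\<in>U - {v}. c' u *\<^sub>R u) = (\<Sum>u\<in>U. c' u *\<^sub>R u)"
        by (rule rem) (simp add: c'v)
      also have "\<dots> = (\<Sum>u\<in>U. c u *\<^sub>R u) + \<tau> *\<^sub>R (\<Sum>u\<in>U. d u *\<^sub>R u)"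
        by (simp add: c'_def scaleR_add_left sum.distrib scaleR_sum_right)
      finally show ?thesis using d(2) by simp
    qed
    have le: "sum c U \<le> sum c' (U - {v})"
    proof -
      have "sum c' (U - {v}) = sum c' U" by (rule rem) (rule c'v)
      also have "\<dots> = sum c U + \<tau> * sum d U"
        by (simp add: c'_def sum.distrib sum_distrib_left)
      finally show ?thesis using \<tau> d(3) by simp
    qed
    \<comment> \<open>A relation on \<open>U - {v}\<close> extends to \<open>U\<close> with
      coefficient 0 at \<open>v\<close>.\<close>
    have pointed': "\<forall>u\<in>U - {v}. e u = 0"
      if e: "\<And>u. u \<in> U - {v} \<Longrightarrow> 0 \<le> e u" "(\<Sum>u\<in>U - {v}. e u *\<^sub>R u) = 0" for e :: "'a \<Rightarrow> real"
    proof -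
      have "(\<Sum>u\<in>U. (e(v := 0)) u *\<^sub>R u) = (\<Sum>u\<in>U - {v}. (e(v := 0)) u *\<^sub>R u)"
        by (rule rem[symmetric]) simp
      also have "\<dots> = (\<Sum>u\<in>U - {v}. e u *\<^sub>R u)" by (intro sum.cong) auto
      finally have 0: "\<forall>u\<in>U. (e(v := 0)) u = 0"
        using e by (intro pointed) auto
      show ?thesis
      proof
        fix u assume "u \<in> U - {v}"
        then show "e u = 0" using bspec[OF 0, of u] by simp
      qed
    qed
    have "U - {v} \<subset> U" using vU(1) by blast
    moreover have "0 \<le> c' u" if "u \<in> U - {v}" for u using c'_nonneg that by blast
    ultimately obtain V c'' where "V \<subseteq> U - {v}" "independent V" "\<forall>u\<in>V. 0 \<le> c'' u"
      "(\<Sum>u\<in>V. c'' u *\<^sub>R u) = (\<Sum>u\<in>U - {v}. c' u *\<^sub>R u)" "sum c' (U - {v}) \<le> sum c'' V"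
      using psubset.IH[of "U - {v}" c', OF _ _ pointed'] by blast
    with eq le show ?thesis by (intro exI[of _ V] exI[of _ c'']) auto
  qed
qed

text \<open>At a point of \<open>W\<close> the vanishing sum has nonnegative terms, so each term is
  0; for each \<open>u\<close> the point is chosen where \<open>u\<close> does not vanish. Thus
  elements nonnegative on \<open>W\<close>, none vanishing on all of it, generate a pointed
  cone.\<close>

lemma pointed_combination:
  fixes W :: "'a::real_inner set"
  assumes "finite U" "\<And>u p. u \<in> U \<Longrightarrow> p \<in> W \<Longrightarrow> 0 \<le> u \<bullet> p"
    and "\<And>u. u \<in> U \<Longrightarrow> \<exists>p\<in>W. u \<bullet> p \<noteq> 0"
    and "\<And>u. u \<in> U \<Longrightarrow> 0 \<le> d u" "(\<Sum>u\<in>U. d u *\<^sub>R u) = 0"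
  shows "\<forall>u\<in>U. d u = 0"
proof
  fix u assume u: "u \<in> U"
  obtain p where p: "p \<in> W" "u \<bullet> p \<noteq> 0" using assms(3)[OF u] by blast
  have "(\<Sum>u\<in>U. d u * (u \<bullet> p)) = (\<Sum>u\<in>U. d u *\<^sub>R u) \<bullet> p"
    by (simp add: inner_sum_left)
  then have "(\<Sum>u\<in>U. d u * (u \<bullet> p)) = 0" using assms(5) by simp
  then have "d u * (u \<bullet> p) = 0"
    using assms(1,2,4) p(1) u by (subst (asm) sum_nonneg_eq_0_iff) auto
  with p(2) show "d u = 0" by simp
qed

text \<open>At each point of \<open>S\<close> the members of weight above 1/2 have total value less than 2, hence at
  most 1, so the sum of these members can be split off from the constant function 1.\<close>

lemma unit_decomposition_exists:
  fixes S :: "(real ^ 'n) set" and U :: "((real ^ 'n) \<times> real) set" and c :: "(real ^ 'n) \<times> real \<Rightarrow> real"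
  assumes S: "finite S" "S \<subseteq> int_vecs"
    and full: "\<And>u :: (real ^ 'n) \<times> real. (\<And>p. p \<in> S \<Longrightarrow> u \<bullet> (p, 1) = 0) \<Longrightarrow> u = 0"
    and U: "finite U" "U \<subseteq> int_vecs \<times> \<int>" "0 \<notin> U" "\<And>u p. u \<in> U \<Longrightarrow> p \<in> S \<Longrightarrow> 0 \<le> u \<bullet> (p, 1)"
    and c: "\<And>u. u \<in> U \<Longrightarrow> 0 \<le> c u" "(\<Sum>u\<in>U. c u *\<^sub>R u) = (0, 1)"
  shows "\<exists>t w. unit_decomposition S t w \<and>
    (t = CARD('n) \<or> 2 * sum c U \<le> real CARD('n) + 1 + real t)"
proof -
  have nz: "\<exists>p\<in>(\<lambda>p. (p, 1)) ` S. u \<bullet> p \<noteq> 0" if "u \<in> U" for u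
    using full[of u] that U(3) by blast
  have "\<exists>V c'. V \<subseteq> U \<and> independent V \<and> (\<forall>u\<in>V. 0 \<le> c' u) \<and>
    (\<Sum>u\<in>V. c' u *\<^sub>R u) = (\<Sum>u\<in>U. c u *\<^sub>R u) \<and> sum c U \<le> sum c' V"
    by (rule independent_nonneg_combination[OF U(1) c(1)], assumption,
        rule pointed_combination[OF U(1) _ nz, rotated]) (use U(4) in auto)
  then obtain V c' where V: "V \<subseteq> U" "independent V" and c': "\<And>u. u \<in> V \<Longrightarrow> 0 \<le> c' u"
    "(\<Sum>u\<in>V. c' u *\<^sub>R u) = (0, 1)" and le: "sum c U \<le> sum c' V"
    unfolding c(2) by blast
  have finV: "finite V" using V(1) U(1) by (rule finite_subset)
  have cardV: "card V \<le> CARD('n) + 1"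
    using independent_bound[OF V(2)] by simp
  have val_int: "u \<bullet> (p, 1) \<in> \<int>" if "u \<in> int_vecs \<times> \<int>" "p \<in> S"
    for u :: "(real ^ 'n) \<times> real" and p
  proof -
    have "p \<in> int_vecs" using S(2) that(2) by blast
    then show ?thesis using that(1) by (auto simp: inner_prod_def int_vecs_inner)
  qed
  have val_nonneg: "0 \<le> u \<bullet> (p, 1)" if "u \<in> V" "p \<in> S" for u p
    using U(4) V(1) that by blast
  have val_sum: "(\<Sum>u\<in>V. c' u * (u \<bullet> (p, 1))) = 1" for p
  proof -
    have "(\<Sum>u\<in>V. c' u * (u \<bullet> (p, 1))) = (\<Sum>u\<in>V. c' u *\<^sub>R u) \<bullet> (p, 1)"
      by (simp only: inner_sum_left inner_scaleR_left)
    then show ?thesis by (simp add: c'(2))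
  qed
  \<comment> \<open>Some value of \<open>u\<close> on \<open>S\<close> is a positive integer, while
    the weighted values there sum to 1.\<close>
  have c'_le1: "c' u \<le> 1" if u: "u \<in> V" for u
  proof -
    obtain p where p: "p \<in> S" "u \<bullet> (p, 1) \<noteq> 0" using nz[of u] u V(1) by blast
    have "u \<bullet> (p, 1) \<in> \<int>" using val_int u V(1) U(2) p(1) by blast
    then have "1 \<le> \<bar>u \<bullet> (p, 1)\<bar>" using p(2) by (rule Ints_nonzero_abs_ge1)
    then have "1 \<le> u \<bullet> (p, 1)" using val_nonneg[OF u p(1)] by simp
    then have "c' u * 1 \<le> c' u * (u \<bullet> (p, 1))" using c'(1)[OF u] by (rule mult_left_mono)
    also have "\<dots> \<le> (\<Sum>u\<in>V. c' u * (u \<bullet> (p, 1)))"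
      using u finV c'(1) val_nonneg[OF _ p(1)] by (intro member_le_sum) auto
    finally show ?thesis by (simp add: val_sum)
  qed
  define X where "X = {u \<in> V. c' u > 1/2}"
  have XV: "X \<subseteq> V" and finX: "finite X" using finV by (auto simp: X_def)
  have X_le1: "(\<Sum>u\<in>X. u \<bullet> (p, 1)) \<le> 1" if p: "p \<in> S" for p
  proof (rule ccontr)
    assume "\<not> ?thesis"
    moreover have "(\<Sum>u\<in>X. u \<bullet> (p, 1)) \<in> \<int>"
      using val_int p XV V(1) U(2) by (intro Ints_sum) blast
    ultimately have ge2: "2 \<le> (\<Sum>u\<in>X. u \<bullet> (p, 1))"
      by (elim Ints_cases) auto
    have nonneg: "0 \<le> (c' u - 1/2) * (u \<bullet> (p, 1))" if "u \<in> X" for u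
      using that val_nonneg[OF _ p] XV by (intro mult_nonneg_nonneg) (auto simp: X_def)
    \<comment> \<open>The part of the weighted sum over \<open>X\<close> is at most 1, whereas half
      the sum of values is at least 1. As the weights strictly exceed 1/2, all values on
      \<open>X\<close> would be 0, contrary to \<open>ge2\<close>.\<close>
    have "(\<Sum>u\<in>X. c' u * (u \<bullet> (p, 1))) \<le> (\<Sum>u\<in>V. c' u * (u \<bullet> (p, 1)))"
      using finV XV c'(1) val_nonneg[OF _ p] by (intro sum_mono2) auto
    then have "(\<Sum>u\<in>X. (c' u - 1/2) * (u \<bullet> (p, 1))) \<le> 0"
      using ge2 by (simp add: val_sum left_diff_distrib sum_subtractf flip: sum_divide_distrib)
    then have "(\<Sum>u\<in>X. (c' u - 1/2) * (u \<bullet> (p, 1))) = 0"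
      using nonneg by (simp add: sum_nonneg order_antisym)
    then have "\<forall>u\<in>X. (c' u - 1/2) * (u \<bullet> (p, 1)) = 0"
      using sum_nonneg_eq_0_iff[OF finX, of "\<lambda>u. (c' u - 1/2) * (u \<bullet> (p, 1))"] nonneg by blast
    then have "\<forall>u\<in>X. u \<bullet> (p, 1) = 0" by (auto simp: X_def)
    then have "(\<Sum>u\<in>X. u \<bullet> (p, 1)) = 0" by (intro sum.neutral)
    then show False using ge2 by linarith
  qed
  define r where "r = (0, 1) - \<Sum>X"
  have XU: "\<And>u. u \<in> X \<Longrightarrow> u \<in> int_vecs \<times> \<int>" "\<And>u. u \<in> X \<Longrightarrow> u \<noteq> 0"
    "\<And>u p. u \<in> X \<Longrightarrow> p \<in> S \<Longrightarrow> 0 \<le> u \<bullet> (p, 1)"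
    using XV V(1) U(2-4) by blast+
  \<comment> \<open>Serves both cases below: a list of members of \<open>X\<close>, possibly with
    the nonzero remainder \<open>r\<close>, whose sum is the constant 1.\<close>
  have decomp: "unit_decomposition S t w"
    if "\<And>i. i \<le> t \<Longrightarrow> w i \<in> X \<or> w i = r \<and> r \<noteq> 0" "(\<Sum>i\<le>t. w i) = (0, 1)" for t w
  proof
    have "\<Sum>X \<in> int_vecs \<times> \<int>"
      by (intro sub_closed_sum) (use XU(1) int_vecs_0 int_vecs_diff in \<open>auto simp: zero_prod_def\<close>)
    then have r_int: "r \<in> int_vecs \<times> \<int>"
      unfolding r_def using int_vecs_diff[OF int_vecs_0] by (auto simp: mem_Times_iff)
    have r_nonneg: "0 \<le> r \<bullet> (p, 1)" if "p \<in> S" for p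
      using X_le1[OF that] by (simp add: r_def inner_diff_left inner_sum_left)
    fix i assume "i \<le> t"
    note wi = that(1)[OF this]
    show "w i \<in> int_vecs \<times> \<int>" using wi XU(1)[of "w i"] r_int by metis
    show "w i \<noteq> 0" using wi XU(2)[of "w i"] by metis
    show "0 \<le> w i \<bullet> (p, 1)" if "p \<in> S" for p
      using wi XU(3)[of "w i" p] r_nonneg[of p] that by metis
  qed (use S full that(2) in auto)
  show ?thesis
  proof (cases "r = 0")
    case False
    obtain \<beta> where \<beta>: "bij_betw \<beta> {1..card X} X"
      using ex_bij_betw_nat_finite_1[OF finX] by blast
    define w where "w = (\<lambda>i. if i = 0 then r else \<beta> i)"
    have "{..card X} = insert 0 {1..card X}" by auto
    then have "(\<Sum>i\<le>card X. w i) = r + (\<Sum>i\<in>{1..card X}. w i)" by (simp add: w_def)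
    also have "(\<Sum>i\<in>{1..card X}. w i) = (\<Sum>i\<in>{1..card X}. \<beta> i)"
      by (intro sum.cong) (auto simp: w_def)
    also have "\<dots> = \<Sum>X" using sum.reindex_bij_betw[OF \<beta>, of "\<lambda>x. x"] .
    finally have "(\<Sum>i\<le>card X. w i) = (0, 1)" by (simp add: r_def)
    moreover have "w i \<in> X \<or> w i = r \<and> r \<noteq> 0" if "i \<le> card X" for i
      using \<beta> that False by (auto simp: w_def bij_betw_def)
    ultimately have "unit_decomposition S (card X) w" by (intro decomp)
    \<comment> \<open>Weights are at most 1 on \<open>X\<close> and at most 1/2 elsewhere, so twice
      the total is at most \<open>card V + card X\<close>, with \<open>card V \<le> n + 1\<close>.
      Here \<open>t = card X\<close>, since \<open>r\<close> takes index 0.\<close>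
    moreover have "2 * sum c U \<le> real CARD('n) + 1 + real (card X)"
    proof -
      have "sum c' V = sum c' (V - X) + sum c' X" using sum.subset_diff[OF XV finV] .
      also have "sum c' (V - X) \<le> (\<Sum>u\<in>V - X. 1/2)" by (intro sum_mono) (auto simp: X_def)
      also have "sum c' X \<le> (\<Sum>u\<in>X. 1)" using c'_le1 XV by (intro sum_mono) auto
      finally have "2 * sum c' V \<le> real (card (V - X)) + 2 * real (card X)" by simp
      also have "real (card (V - X)) = real (card V) - real (card X)"
        using card_Diff_subset[OF finX XV] card_mono[OF finV XV] by simp
      finally show ?thesis using cardV le by linarith
    qed
    ultimately show ?thesis by blast
  next
    case True
    then have sumX: "\<Sum>X = (0, 1)" by (simp add: r_def)
    then have "X \<noteq> {}" by (auto simp: zero_prod_def)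
    then obtain t where t: "card X = Suc t" using finX by (metis card_0_eq not0_implies_Suc)
    obtain \<beta> where \<beta>: "bij_betw \<beta> {0..<card X} X"
      using ex_bij_betw_nat_finite[OF finX] by blast
    have t': "{0..<card X} = {..t}" unfolding t by auto
    have "(\<Sum>i\<le>t. \<beta> i) = (0, 1)"
      using sum.reindex_bij_betw[OF \<beta>, of "\<lambda>x. x"] sumX unfolding t' by simp
    moreover have "\<beta> i \<in> X \<or> \<beta> i = r \<and> r \<noteq> 0" if "i \<le> t" for i
      using \<beta> that unfolding t' by (auto simp: bij_betw_def)
    ultimately have ud: "unit_decomposition S t \<beta>" by (intro decomp)
    \<comment> \<open>Both \<open>c'\<close> and the indicator function of \<open>X\<close>
      represent the constant 1 over the independent set \<open>V\<close>, so they coincide and the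
      total weight is \<open>card X = t + 1\<close>.\<close>
    have "(\<Sum>u\<in>V. (if u \<in> X then 1 else 0) *\<^sub>R u) = (\<Sum>u\<in>V. if u \<in> X then u else 0)"
      by (intro sum.cong) auto
    also have "\<dots> = \<Sum>X"
      using finV XV by (simp add: sum.If_cases Int_absorb1)
    finally have "(\<Sum>u\<in>V. (c' u - (if u \<in> X then 1 else 0)) *\<^sub>R u) = 0"
      using c'(2) sumX by (simp only: scaleR_diff_left sum_subtractf diff_self)
    then have "c' u - (if u \<in> X then 1 else 0) = 0" if "u \<in> V" for u
      using independentD[OF V(2) finV order_refl, of "\<lambda>u. c' u - (if u \<in> X then 1 else 0)"] that by blast
    then have "sum c' V = (\<Sum>u\<in>V. if u \<in> X then 1 else 0)" by (intro sum.cong) auto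
    also have "\<dots> = real (card X)" using finV XV by (simp add: sum.If_cases Int_absorb1)
    finally have "sum c U \<le> real t + 1" using le t by simp
    moreover have "t \<le> CARD('n)" using unit_decomposition.card_le[OF ud] .
    \<comment> \<open>For \<open>t < n\<close> the bound follows from
      \<open>2 * (t + 1) \<le> n + 1 + t\<close>.\<close>
    ultimately have "t = CARD('n) \<or> 2 * sum c U \<le> real CARD('n) + 1 + real t" by linarith
    with ud show ?thesis by blast
  qed
qed

section \<open>Duality for the fine codegree\<close>

text \<open>A linear function attains its minimum over a hull at a generator. For integral
  \<open>a\<close> and \<open>S\<close> the minimum is therefore an integer.\<close>

lemma dist_fine_convex_hull:
  assumes "finite S" "S \<noteq> {}"
  shows "\<exists>p\<in>S. dist_fine (convex hull S) a = a \<bullet> p"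
    and "x \<in> convex hull S \<Longrightarrow> dist_fine (convex hull S) a \<le> a \<bullet> x"
proof -
  obtain p where p: "p \<in> S" "\<And>q. q \<in> S \<Longrightarrow> a \<bullet> p \<le> a \<bullet> q"
    using arg_min_if_finite[OF assms, of "\<lambda>q. a \<bullet> q"] by (metis not_less)
  have "convex hull S \<subseteq> {x. a \<bullet> x \<ge> a \<bullet> p}"
    by (intro hull_minimal convex_halfspace_ge) (use p in auto)
  then have min: "a \<bullet> p \<le> a \<bullet> x" if "x \<in> convex hull S" for x using that by blast
  have eq: "dist_fine (convex hull S) a = a \<bullet> p"
    unfolding dist_fine_def
    by (rule cInf_eq_minimum) (use p(1) min hull_inc in \<open>auto intro: hull_inc\<close>)
  show "\<exists>p\<in>S. dist_fine (convex hull S) a = a \<bullet> p" using p(1) eq by blast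
  show "x \<in> convex hull S \<Longrightarrow> dist_fine (convex hull S) a \<le> a \<bullet> x"
    unfolding eq by (rule min)
qed

lemma axis_int_vecs: "axis i 1 \<in> int_vecs - {0}" "- axis i 1 \<in> int_vecs - {0}"
  by (auto simp: int_vecs_def axis_def vec_eq_iff)

text \<open>The constraints belonging to \<open>\<plusminus> e\<^sub>i\<close> confine the fine adjoint polytope to a compact box.\<close>

lemma fine_adjoint_empty_finite:
  fixes P :: "(real ^ 'n) set"
  assumes "fine_adjoint P s = {}"
  obtains A where "finite A" "A \<subseteq> int_vecs - {0}" "\<forall>i. axis i 1 \<in> A \<and> - axis i 1 \<in> A"
    "\<forall>x. \<exists>a\<in>A. a \<bullet> x < dist_fine P a + s"
proof -
  define H where "H = (\<lambda>a. {x. a \<bullet> x \<ge> dist_fine P a + s})"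
  define K where "K = cbox (\<chi> i. dist_fine P (axis i 1) + s) (\<chi> i :: 'n. - (dist_fine P (- axis i 1) + s))"
  have K: "x \<in> K" if "\<And>i. x \<in> H (axis i 1)" "\<And>i. x \<in> H (- axis i 1)" for x
    unfolding K_def mem_box_cart
  proof
    fix i
    show "(\<chi> i. dist_fine P (axis i 1) + s) $ i \<le> x $ i \<and>
        x $ i \<le> (\<chi> i. - (dist_fine P (- axis i 1) + s)) $ i"
      using that(1)[of i] that(2)[of i] by (simp add: H_def inner_axis')
  qed
  have "K \<inter> (\<Inter>a\<in>int_vecs - {0}. H a) = {}"
    using assms by (auto simp: fine_adjoint_def H_def)
  moreover have "compact K" unfolding K_def by (rule compact_cbox)
  moreover have "closed (H a)" for a unfolding H_def by (rule closed_halfspace_ge)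
  ultimately obtain I where I: "finite I" "I \<subseteq> int_vecs - {0}" "K \<inter> (\<Inter>a\<in>I. H a) = {}"
    using compact_imp_fip_image[of K "int_vecs - {0}" H] by blast
  \<comment> \<open>With the vectors \<open>\<plusminus> e_i\<close> included, the constraints from
    \<open>A\<close> already force a point into the box \<open>K\<close>.\<close>
  define A where "A = I \<union> range (\<lambda>i. axis i 1) \<union> range (\<lambda>i. - axis i 1)"
  have "\<exists>a\<in>A. a \<bullet> x < dist_fine P a + s" for x
  proof (rule ccontr)
    assume "\<not> ?thesis"
    then have "\<forall>a\<in>A. x \<in> H a" by (auto simp: H_def not_less)
    then have "x \<in> K \<inter> (\<Inter>a\<in>I. H a)" by (auto simp: A_def intro!: K)
    with I(3) show False by blast
  qed
  moreover have "A \<subseteq> int_vecs - {0}"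
    unfolding A_def by (intro Un_least image_subsetI I(2) axis_int_vecs)
  ultimately show ?thesis using that[of A] I(1) by (auto simp: A_def)
qed

text \<open>A form of Farkas' lemma with weights normalised to sum 1: if the hull of the points
  \<open>(a, h a)\<close> missed the ray over 0, a strictly separating functional
  \<open>(z, \<omega>)\<close> would yield a feasible point.\<close>

lemma infeasible_certificate:
  fixes A :: "(real ^ 'n) set" and h :: "real ^ 'n \<Rightarrow> real"
  assumes A: "finite A" "axis i 1 \<in> A" "- axis i 1 \<in> A"
    and inf: "\<And>x. \<exists>a\<in>A. a \<bullet> x < h a"
  obtains c where "\<And>a. a \<in> A \<Longrightarrow> 0 \<le> c a" "sum c A = 1" "(\<Sum>a\<in>A. c a *\<^sub>R a) = 0"
    "0 \<le> (\<Sum>a\<in>A. c a * h a)"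
proof -
  let ?C = "convex hull ((\<lambda>a. (a, h a)) ` A)" and ?D = "{0 :: real ^ 'n} \<times> {0 :: real..}"
  have "?C \<inter> ?D \<noteq> {}"
  proof
    assume "?C \<inter> ?D = {}"
    moreover have "convex ?D" by (intro convex_Times) auto
    moreover have "closed ?D" by (intro closed_Times) auto
    moreover have "compact ?C" using A(1) by (intro finite_imp_compact_convex_hull) auto
    moreover have "?C \<noteq> {}" using A(2) by auto
    ultimately have "\<exists>v b. (\<forall>x\<in>?C. v \<bullet> x < b) \<and> (\<forall>x\<in>?D. v \<bullet> x > b)"
      by (intro separating_hyperplane_compact_closed convex_convex_hull)
    then obtain v b where v: "\<And>x. x \<in> ?C \<Longrightarrow> v \<bullet> x < b" "\<And>x. x \<in> ?D \<Longrightarrow> v \<bullet> x > b"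
      by blast
    obtain z \<omega> where v_eq: "v = (z, \<omega>)" by (cases v)
    have D: "\<omega> * y > b" if "y \<ge> 0" for y using v(2)[of "(0, y)"] that by (simp add: v_eq)
    have C: "z \<bullet> a + \<omega> * h a < b" if "a \<in> A" for a
      using v(1)[of "(a, h a)"] that by (simp add: v_eq hull_inc)
    have b: "b < 0" using D[of 0] by simp
    have "\<omega> \<ge> 0"
    proof (rule ccontr)
      assume "\<not> \<omega> \<ge> 0"
      then show False using D[of "b / \<omega>"] b by (simp add: divide_nonpos_neg)
    qed
    then consider "\<omega> = 0" | "\<omega> > 0" by fastforce
    then show False
    proof cases
      case 1
      \<comment> \<open>With \<open>\<omega> = 0\<close>, the numbers
        \<open>z \<bullet> axis i 1\<close> and its negative would both be negative.\<close>
      then show False using C[OF A(2)] C[OF A(3)] b by simp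
    next
      case 2
      \<comment> \<open>The point \<open>- z / \<omega>\<close> would satisfy all constraints from
        \<open>A\<close>.\<close>
      obtain a where a: "a \<in> A" "a \<bullet> ((- 1 / \<omega>) *\<^sub>R z) < h a" using inf by blast
      then have "- (z \<bullet> a) / \<omega> < h a" by (simp add: inner_commute)
      then have "- (z \<bullet> a) < \<omega> * h a" unfolding pos_divide_less_eq[OF 2] by (simp only: mult.commute)
      then show False using C[OF a(1)] b by simp
    qed
  qed
  then obtain y where y: "y \<ge> 0" "(0, y) \<in> ?C" by auto
  have inj: "inj_on (\<lambda>a. (a, h a)) A" by (simp add: inj_on_def)
  from y(2) A(1) obtain d where d: "\<And>x. x \<in> (\<lambda>a. (a, h a)) ` A \<Longrightarrow> 0 \<le> d x"
    "sum d ((\<lambda>a. (a, h a)) ` A) = 1" "(\<Sum>x\<in>(\<lambda>a. (a, h a)) ` A. d x *\<^sub>R x) = (0, y)"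
    by (subst (asm) convex_hull_finite) auto
  let ?c = "\<lambda>a. d (a, h a)"
  have sum: "(\<Sum>a\<in>A. ?c a *\<^sub>R (a, h a)) = (0, y)" using d(3) by (simp add: sum.reindex[OF inj])
  show ?thesis
  proof (rule that[of ?c])
    show "sum ?c A = 1" using d(2) by (simp add: sum.reindex[OF inj])
    show "(\<Sum>a\<in>A. ?c a *\<^sub>R a) = 0" using arg_cong[OF sum, of fst] by (simp add: fst_sum)
    show "0 \<le> (\<Sum>a\<in>A. ?c a * h a)" using arg_cong[OF sum, of snd] y(1) by (simp add: snd_sum)
  qed (use d(1) in auto)
qed

text \<open>An affine function that vanishes on \<open>S\<close> vanishes on its affine hull, the
  whole space; the points 0 and \<open>a\<close> then give \<open>b = 0\<close> and
  \<open>a = 0\<close>.\<close>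

lemma full_dimensional_vanishing:
  fixes S :: "(real ^ 'n) set" and u :: "(real ^ 'n) \<times> real"
  assumes "aff_dim (convex hull S) = int CARD('n)" "\<And>p. p \<in> S \<Longrightarrow> u \<bullet> (p, 1) = 0"
  shows "u = 0"
proof -
  obtain a b where u: "u = (a, b)" by (cases u)
  have "affine hull S = UNIV"
    using assms(1) by (simp add: aff_dim_convex_hull flip: aff_dim_eq_full)
  moreover have "affine hull S \<subseteq> {x. a \<bullet> x = - b}"
    by (intro hull_minimal affine_hyperplane) (use assms(2) in \<open>auto simp: u eq_neg_iff_add_eq_0\<close>)
  ultimately have "a \<bullet> x = - b" for x by blast
  from this[of 0] this[of a] show ?thesis by (simp add: u zero_prod_def)
qed

text \<open>Each constraint vector \<open>a\<close> gives the integral affine function with linear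
  part \<open>a\<close> and minimum 0 on the polytope. The certificate combines these to a constant
  \<open>\<kappa>\<close> with \<open>0 < \<kappa> \<le> s\<close>; division by
  \<open>\<kappa>\<close> yields the constant 1 with total weight
  \<open>1 / \<kappa>\<close>.\<close>

lemma fine_adjoint_empty_combination:
  fixes S :: "(real ^ 'n) set"
  assumes S: "finite S" "S \<noteq> {}" "S \<subseteq> int_vecs" "aff_dim (convex hull S) = int CARD('n)"
    and s: "s > 0" "fine_adjoint (convex hull S) s = {}"
  obtains U :: "((real ^ 'n) \<times> real) set" and c where "finite U" "U \<subseteq> int_vecs \<times> \<int>" "0 \<notin> U"
    "\<forall>u\<in>U. \<forall>p\<in>S. 0 \<le> u \<bullet> (p, 1)" "\<forall>u\<in>U. 0 \<le> c u" "(\<Sum>u\<in>U. c u *\<^sub>R u) = (0, 1)" "1 / s \<le> sum c U"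
proof -
  let ?d = "dist_fine (convex hull S)"
  obtain A where A: "finite A" "A \<subseteq> int_vecs - {0}" "\<forall>i. axis i 1 \<in> A \<and> - axis i 1 \<in> A"
    "\<forall>x. \<exists>a\<in>A. a \<bullet> x < ?d a + s"
    by (rule fine_adjoint_empty_finite[OF s(2)])
  \<comment> \<open>The index \<open>undefined\<close> stands for an arbitrary coordinate.\<close>
  obtain c where c: "\<And>a. a \<in> A \<Longrightarrow> 0 \<le> c a" "sum c A = 1" "(\<Sum>a\<in>A. c a *\<^sub>R a) = 0"
    "0 \<le> (\<Sum>a\<in>A. c a * (?d a + s))"
    by (rule infeasible_certificate[of A undefined "\<lambda>a. ?d a + s"]) (use A in blast)+
  define u where "u = (\<lambda>a. (a, - ?d a))"
  have inj: "inj_on u A" by (simp add: inj_on_def u_def)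
  have u_int: "u ` A \<subseteq> int_vecs \<times> \<int>"
  proof (rule image_subsetI)
    fix a assume "a \<in> A"
    then have a: "a \<in> int_vecs" using A(2) by blast
    obtain p where "p \<in> S" "?d a = a \<bullet> p" using dist_fine_convex_hull(1)[OF S(1,2)] by blast
    with a S(3) have "?d a \<in> \<int>" using int_vecs_inner by auto
    with a show "u a \<in> int_vecs \<times> \<int>" by (simp add: u_def)
  qed
  have u_nz: "0 \<notin> u ` A" using A(2) by (auto simp: u_def zero_prod_def)
  have u_nonneg: "0 \<le> u a \<bullet> (p, 1)" if "p \<in> S" for a p
    using dist_fine_convex_hull(2)[OF S(1,2), of p a] hull_inc[OF that] by (simp add: u_def)
  define \<kappa> where "\<kappa> = (\<Sum>a\<in>A. c a * (- ?d a))"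
  have sum_u: "(\<Sum>a\<in>A. c a *\<^sub>R u a) = (0, \<kappa>)"
    by (rule prod_eqI) (simp_all add: fst_sum snd_sum u_def c(3) \<kappa>_def)
  have "\<kappa> \<le> s"
    using c(4) c(2) by (simp add: \<kappa>_def distrib_left sum.distrib sum_negf flip: sum_distrib_right)
  \<comment> \<open>A vanishing nonnegative combination would have only zero weights, but the
    weights sum to 1.\<close>
  have "\<kappa> \<noteq> 0"
  proof
    assume "\<kappa> = 0"
    then have "(\<Sum>v\<in>u ` A. c (fst v) *\<^sub>R v) = 0"
      using sum_u by (simp add: sum.reindex[OF inj] zero_prod_def) (simp add: u_def)
    then have "\<forall>v\<in>u ` A. c (fst v) = 0"
    proof (intro pointed_combination[where W = "(\<lambda>p. (p, 1)) ` S"])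
      show "\<exists>p\<in>(\<lambda>p. (p, 1)) ` S. v \<bullet> p \<noteq> 0" if "v \<in> u ` A" for v
        using full_dimensional_vanishing[OF S(4), of v] u_nz that by blast
      show "0 \<le> v \<bullet> p" if "v \<in> u ` A" "p \<in> (\<lambda>p. (p, 1)) ` S" for v p
        using that u_nonneg by auto
      show "0 \<le> c (fst v)" if "v \<in> u ` A" for v using that c(1) by (auto simp: u_def)
    qed (use A(1) in auto)
    then have "sum c A = 0" by (intro sum.neutral) (auto simp: u_def)
    with c(2) show False by simp
  qed
  moreover have "\<kappa> \<ge> 0"
  proof -
    obtain p where p: "p \<in> S" using S(2) by blast
    have "(0, \<kappa>) \<bullet> (p, 1) = (\<Sum>a\<in>A. c a * (u a \<bullet> (p, 1)))"
      unfolding sum_u[symmetric] by (simp only: inner_sum_left inner_scaleR_left)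
    also have "\<dots> \<ge> 0" using c(1) u_nonneg[OF p] by (intro sum_nonneg mult_nonneg_nonneg) auto
    finally show ?thesis by simp
  qed
  ultimately have \<kappa>: "0 < \<kappa>" by simp
  show ?thesis
  proof (rule that[of "u ` A" "\<lambda>v. c (fst v) / \<kappa>"])
    show "finite (u ` A)" using A(1) by simp
    show "\<forall>v\<in>u ` A. \<forall>p\<in>S. 0 \<le> v \<bullet> (p, 1)" using u_nonneg by blast
    show "\<forall>v\<in>u ` A. 0 \<le> c (fst v) / \<kappa>" using c(1) \<kappa> by (auto simp: u_def)
    have "(\<Sum>v\<in>u ` A. (c (fst v) / \<kappa>) *\<^sub>R v) = (1 / \<kappa>) *\<^sub>R (\<Sum>a\<in>A. c a *\<^sub>R u a)"
      unfolding sum.reindex[OF inj] scaleR_sum_right o_def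
      by (intro sum.cong) (auto simp: u_def)
    then show "(\<Sum>v\<in>u ` A. (c (fst v) / \<kappa>) *\<^sub>R v) = (0, 1)" using \<kappa> by (simp add: sum_u)
    have "(\<Sum>v\<in>u ` A. c (fst v) / \<kappa>) = (\<Sum>a\<in>A. c a / \<kappa>)"
      unfolding sum.reindex[OF inj] o_def by (simp add: u_def)
    also have "\<dots> = 1 / \<kappa>" by (simp add: c(2) flip: sum_divide_distrib)
    finally show "1 / s \<le> (\<Sum>v\<in>u ` A. c (fst v) / \<kappa>)"
      using \<kappa> \<open>\<kappa> \<le> s\<close> by (simp add: frac_le)
  qed (use u_int u_nz in auto)
qed

section \<open>Positivity of the fine codegree and its comparison with the dimension bound\<close>

lemma int_vec_norm_ge_1:
  assumes "a \<in> int_vecs" "a \<noteq> 0" shows "1 \<le> norm a"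
proof -
  obtain i where i: "a $ i \<noteq> 0" using assms(2) by (auto simp: vec_eq_iff)
  then have "1 \<le> \<bar>a $ i\<bar>" using assms(1) by (intro Ints_nonzero_abs_ge1) (auto simp: int_vecs_def)
  also have "\<dots> \<le> norm a" by (rule component_le_norm_cart)
  finally show ?thesis .
qed

text \<open>The centre of a ball of radius \<open>e\<close> inside the polytope works for
  \<open>s = e\<close>: the minimum of \<open>a\<close> on the ball lies \<open>e * norm a\<close>
  below its value at the centre, and nonzero integral vectors have norm at least 1.\<close>

lemma fine_adjoint_nonempty:
  fixes S :: "(real ^ 'n) set"
  assumes S: "finite S" "S \<noteq> {}" "aff_dim (convex hull S) = int CARD('n)"
  shows "\<exists>s>0. fine_adjoint (convex hull S) s \<noteq> {}"
proof -
  have "interior (convex hull S) = rel_interior (convex hull S)"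
    using S(3) by (simp add: interior_rel_interior_gen)
  moreover have "rel_interior (convex hull S) \<noteq> {}"
    using S(2) by (simp add: rel_interior_eq_empty)
  ultimately obtain x where "x \<in> interior (convex hull S)" by blast
  then obtain e where e: "e > 0" "cball x e \<subseteq> convex hull S" by (auto simp: mem_interior_cball)
  have "x \<in> fine_adjoint (convex hull S) e"
    unfolding fine_adjoint_def mem_Collect_eq
  proof
    fix a :: "real ^ 'n" assume "a \<in> int_vecs - {0}"
    then have a: "a \<in> int_vecs" "a \<noteq> 0" by auto
    let ?y = "x - (e / norm a) *\<^sub>R a"
    have "?y \<in> cball x e" using e(1) a(2) by (simp add: dist_norm)
    then have "dist_fine (convex hull S) a \<le> a \<bullet> ?y"
      using dist_fine_convex_hull(2)[OF S(1,2)] e(2) by blast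
    also have "\<dots> = a \<bullet> x - e * norm a"
      using a(2) by (simp add: inner_diff_right dot_square_norm power2_eq_square)
    also have "\<dots> \<le> a \<bullet> x - e" using int_vec_norm_ge_1[OF a] e(1) by simp
    finally show "dist_fine (convex hull S) a + e \<le> a \<bullet> x" by simp
  qed
  with e(1) show ?thesis by blast
qed

text \<open>Adding the constraints of two opposite vectors eliminates \<open>x\<close> and bounds
  \<open>s\<close>, so the supremum in the codegree is a genuine one.\<close>

lemma fine_adjoint_bdd_above:
  "bdd_above {s. s > 0 \<and> fine_adjoint P s \<noteq> {}}"
proof (rule bdd_aboveI)
  fix s assume "s \<in> {s. s > 0 \<and> fine_adjoint P s \<noteq> {}}"
  then obtain x where x: "x \<in> fine_adjoint P s" by blast
  have "dist_fine P (axis undefined 1) + s \<le> axis undefined 1 \<bullet> x"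
    "dist_fine P (- axis undefined 1) + s \<le> - axis undefined 1 \<bullet> x"
    using x axis_int_vecs[of undefined] unfolding fine_adjoint_def by blast+
  then show "s \<le> - (dist_fine P (axis undefined 1) + dist_fine P (- axis undefined 1)) / 2"
    by simp
qed

text \<open>By integrality \<open>m \<le> 2 * n + 1 - \<lceil>2 * \<mu>\<rceil>\<close>. The two
  cases of \<open>dF\<close> bound the ceiling from below, by \<open>2 * \<mu>\<close> for natural
  \<open>\<mu>\<close> and by \<open>2 * \<lfloor>\<mu>\<rfloor> + 1\<close> otherwise.\<close>

lemma dF_ge:
  fixes P :: "(real ^ 'n) set"
  assumes "0 < fine_codegree P" "real t > real_of_int \<lceil>2 * fine_codegree P\<rceil> - 2 - real CARD('n)"
    and "m + t = CARD('n)"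
  shows "real m \<le> dF P"
proof -
  let ?\<mu> = "fine_codegree P"
  have "int t \<ge> \<lceil>2 * ?\<mu>\<rceil> - 1 - int CARD('n)" using assms(2) by linarith
  then have m: "real m \<le> 2 * real CARD('n) + 1 - real_of_int \<lceil>2 * ?\<mu>\<rceil>" using assms(3) by linarith
  show ?thesis
  proof (cases "?\<mu> \<in> \<nat>")
    case True
    then have "dF P = 2 * (real CARD('n) - ?\<mu>) + 1" by (simp add: dF_def)
    then show ?thesis using m le_of_int_ceiling[of "2 * ?\<mu>"] by argo
  next
    case False
    have "of_int \<lfloor>?\<mu>\<rfloor> \<noteq> ?\<mu>"
    proof
      assume "of_int \<lfloor>?\<mu>\<rfloor> = ?\<mu>"
      moreover have "of_int \<lfloor>?\<mu>\<rfloor> = real (nat \<lfloor>?\<mu>\<rfloor>)" using assms(1) by simp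
      ultimately show False using False by (metis of_nat_in_Nats)
    qed
    then have "of_int \<lfloor>?\<mu>\<rfloor> < ?\<mu>" using of_int_floor_le[of ?\<mu>] by linarith
    then have "2 * \<lfloor>?\<mu>\<rfloor> + 1 \<le> \<lceil>2 * ?\<mu>\<rceil>" by linarith
    then have "2 * real_of_int \<lfloor>?\<mu>\<rfloor> + 1 \<le> of_int \<lceil>2 * ?\<mu>\<rceil>" by linarith
    moreover have "dF P = 2 * (real CARD('n) - of_int \<lfloor>?\<mu>\<rfloor>)" using False by (simp add: dF_def)
    ultimately show ?thesis using m by argo
  qed
qed

theorem theorem4p3:
  fixes P :: "(real ^ 'n) set"
  assumes "lattice_polytope int_vecs P"
    and "aff_dim P = int CARD('n)"
    and "\<not> lattice_equiv int_vecs P int_vecs (std_simplex :: (real ^ 'n) set)"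
    and "real CARD('n) > dF P"
  shows "\<exists>m t Q. real m \<le> dF P \<and>
           (\<forall>i\<in>{0..t}. lattice_polytope (int_vecs_dim m) (Q i)) \<and>
           lattice_equiv int_vecs P (int_vecs_dim m \<times> int_vecs_dim t) (cayley_sum t Q)"
proof -
  obtain S where S: "finite S" "S \<noteq> {}" "S \<subseteq> int_vecs" and P: "P = convex hull S"
    using assms(1) by (auto simp: lattice_polytope_def)
  note dim = assms(2)[unfolded P]
  let ?\<mu> = "fine_codegree P" and ?X = "{s. s > 0 \<and> fine_adjoint P s \<noteq> {}}"
  obtain s0 where "s0 \<in> ?X" using fine_adjoint_nonempty[OF S(1,2) dim] P by blast
  then have "s0 \<le> Sup ?X" "s0 > 0" using cSup_upper[OF _ fine_adjoint_bdd_above] by auto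
  then have \<mu>: "0 < ?\<mu>" by (simp add: fine_codegree_def)
  \<comment> \<open>The codegree itself need not be reached: \<open>\<nu>\<close> is taken so close
    below it that \<open>2 * \<nu>\<close> still exceeds the integer preceding
    \<open>\<lceil>2 * \<mu>\<rceil>\<close>. The maximum with 0 keeps \<open>\<nu>\<close>
    positive.\<close>
  obtain \<nu> where \<nu>: "0 < \<nu>" "\<nu> < ?\<mu>" "2 * \<nu> > real_of_int \<lceil>2 * ?\<mu>\<rceil> - 1"
  proof -
    have "max 0 ((real_of_int \<lceil>2 * ?\<mu>\<rceil> - 1) / 2) < ?\<mu>" using \<mu> by (simp add: max_def) linarith
    then obtain \<nu> where "max 0 ((real_of_int \<lceil>2 * ?\<mu>\<rceil> - 1) / 2) < \<nu>" "\<nu> < ?\<mu>"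
      using dense by blast
    then show ?thesis using that[of \<nu>] by auto
  qed
  \<comment> \<open>Since \<open>\<nu>\<close> is below the codegree, \<open>1 / \<nu>\<close> lies
    above the supremum defining it.\<close>
  have "fine_adjoint P (1 / \<nu>) = {}"
  proof (rule ccontr)
    assume "fine_adjoint P (1 / \<nu>) \<noteq> {}"
    then have "1 / \<nu> \<le> Sup ?X" using \<nu>(1) by (intro cSup_upper fine_adjoint_bdd_above) auto
    then have "inverse (Sup ?X) \<le> inverse (1 / \<nu>)" using \<nu>(1) by (intro le_imp_inverse_le) auto
    then show False using \<nu>(2) by (simp add: fine_codegree_def)
  qed
  then have empty: "fine_adjoint (convex hull S) (1 / \<nu>) = {}" by (simp only: P)
  have "1 / \<nu> > 0" using \<nu>(1) by simp
  then obtain U :: "((real ^ 'n) \<times> real) set" and c where U: "finite U" "U \<subseteq> int_vecs \<times> \<int>" "0 \<notin> U"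
    "\<forall>u\<in>U. \<forall>p\<in>S. 0 \<le> u \<bullet> (p, 1)"
    and c: "\<forall>u\<in>U. 0 \<le> c u" "(\<Sum>u\<in>U. c u *\<^sub>R u) = (0, 1)" "1 / (1 / \<nu>) \<le> sum c U"
    by (rule fine_adjoint_empty_combination[OF S dim _ empty])
  have "\<exists>t w. unit_decomposition S t w \<and>
      (t = CARD('n) \<or> 2 * sum c U \<le> real CARD('n) + 1 + real t)"
    by (rule unit_decomposition_exists) (use S U c full_dimensional_vanishing[OF dim] in blast)+
  then obtain t w where ud: "unit_decomposition S t w"
    and t: "t = CARD('n) \<or> 2 * sum c U \<le> real CARD('n) + 1 + real t" by blast
  have "t \<noteq> CARD('n)"
    using unit_decomposition.simplex[OF ud] assms(3) P by blast
  \<comment> \<open>Combine \<open>2 * \<nu> \<le> n + 1 + t\<close> with the choice of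
    \<open>\<nu>\<close>; the strict inequality is what lets \<open>dF_ge\<close> round up.\<close>
  then have "real t > real_of_int \<lceil>2 * ?\<mu>\<rceil> - 2 - real CARD('n)" using t c(3) \<nu>(3) by simp
  moreover obtain m where m: "m + t = CARD('n)"
    using unit_decomposition.card_le[OF ud] le_add_diff_inverse2 by blast
  ultimately have "real m \<le> dF P" using dF_ge[OF \<mu>] by blast
  then show ?thesis using unit_decomposition.cayley[OF ud m] P by blast
qed

end
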